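(* Let $N\ge 2$ and let $H_1,\dots,H_N$ be non-degenerate (finite-energy) Hamiltonians of $N$ qubits. Then for high enough local temperatures there exists a genuinely multipartite entanglement preserving local thermalization; that is, there exists $T_*>0$ such that for all temperatures $T_1,\dots,T_N\ge T_*$, with $\gamma_i$ the thermal state of $H_i$ at temperature $T_i$, there exist a local thermalization $\mathcal{E}$ to $\{\gamma_i\}_{i=1}^N$ and an $N$-qubit state $\rho$ such that $\mathcal{E}(\rho)$ is genuinely multipartite entangled.
   Context: A channel is a completely positive trace-preserving linear map. The thermal state of $H_i$ at temperature $T_i>0$ is $\gamma_i=e^{-H_i/kT_i}/\mathrm{tr}(e^{-H_i/kT_i})$, $k>0$ Boltzmann's constant. A channel $\mathcal{E}$ on $\bigotimes_{i=1}^N\mathcal{H}_i$ is a local thermalization to $\{\gamma_i\}_{i=1}^N$ if (1) $\mathcal{E}=\int\bigotimes_{i=1}^N\mathcal{E}_i^\lambda\,p_\lambda d\lambda$ with each $\mathcal{E}_i^\lambda$ a channel on the $i$-th local system, $p_\lambda\ge0$, $\int p_\lambda d\lambda=1$ (a general probability distribution over $\lambda$); and (2) $\mathrm{tr}_{\backslash i}[\mathcal{E}(\rho)]=\gamma_i$ for every state $\rho$ and every $i$, where $\mathrm{tr}_{\backslash i}$ is the trace over all but the $i$-th system. An $N$-partite state is genuinely multipartite entangled if it is not a convex combination of states each of which is separable with respect to some bipartition of the $N$ parties. *)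

theory Defs
  imports "HOL-Probability.Probability"
begin

section \<open>Operators and states\<close>

text \<open>
  Operators on the space with orthonormal basis \<open>'a\<close> are matrices \<open>complex^'a^'a\<close>, the first index
  being the row. \<open>N\<close> systems, labelled by the finite type \<open>'n\<close>, each with basis \<open>'d\<close>, have the product
  basis \<open>'n \<Rightarrow> 'd\<close>. The predicates \<open>psd_on\<close> and \<open>density_on\<close> take the (finite) basis as a set, so that
  they also apply to ancillas of arbitrary dimension and to the subsystems of a bipartition.
\<close>

definition psd_on :: "'x set \<Rightarrow> ('x \<Rightarrow> 'x \<Rightarrow> complex) \<Rightarrow> bool" where
  "psd_on I A \<longleftrightarrow> (\<forall>v. (\<Sum>x\<in>I. \<Sum>y\<in>I. cnj (v x) * A x y * v y) \<in> \<real>\<^sub>\<ge>\<^sub>0)"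

definition density_on :: "'x set \<Rightarrow> ('x \<Rightarrow> 'x \<Rightarrow> complex) \<Rightarrow> bool" where
  "density_on I A \<longleftrightarrow> psd_on I A \<and> (\<Sum>x\<in>I. A x x) = 1"

definition quantum_state :: "complex^'a^'a \<Rightarrow> bool" where
  "quantum_state \<rho> \<longleftrightarrow> density_on UNIV (\<lambda>x y. \<rho> $ x $ y)"

definition cscale :: "complex \<Rightarrow> complex^'a^'b \<Rightarrow> complex^'a^'b" where
  "cscale c A = (\<chi> i j. c * A $ i $ j)"

definition hermitian :: "complex^'a^'a \<Rightarrow> bool" where
  "hermitian A \<longleftrightarrow> (\<forall>i j. A $ i $ j = cnj (A $ j $ i))"

definition nondegenerate :: "complex^'a^'a \<Rightarrow> bool" where
  "nondegenerate H \<longleftrightarrow> (\<forall>e. vec.dim {v. H *v v = e *s v} \<le> 1)"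


section \<open>Thermal states\<close>

text \<open>
  Multiplication on the type \<open>complex^'a^'a\<close> is componentwise, hence the explicit matrix powers
  and exponential series.
\<close>

primrec mat_power :: "complex^'a^'a \<Rightarrow> nat \<Rightarrow> complex^'a^'a" where
  "mat_power A 0 = mat 1"
| "mat_power A (Suc n) = A ** mat_power A n"

definition mat_exp :: "complex^'a^'a \<Rightarrow> complex^'a^'a" where
  "mat_exp A = (\<Sum>n. (1 / fact n) *\<^sub>R mat_power A n)"

definition thermal_state :: "real \<Rightarrow> complex^'a^'a \<Rightarrow> real \<Rightarrow> complex^'a^'a" where
  "thermal_state k H T =
     (let G = mat_exp ((- 1 / (k * T)) *\<^sub>R H) in cscale (1 / trace G) G)"

lemma mat_exp_summable:
  fixes A :: "complex^'a^'a"
  shows "summable (\<lambda>n. (1 / fact n) *\<^sub>R mat_power A n)"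
proof -
  define C where "C = (\<Sum>i\<in>UNIV. \<Sum>j\<in>UNIV. norm (A $ i $ j))"
  have C0: "C \<ge> 0" unfolding C_def by (intro sum_nonneg) auto
  have row: "(\<Sum>j\<in>UNIV. norm (A $ i $ j)) \<le> C" for i
    unfolding C_def
    by (rule member_le_sum[of i UNIV "\<lambda>i. \<Sum>j\<in>UNIV. norm (A $ i $ j)"]) (auto intro: sum_nonneg)
  have entry: "norm (mat_power A n $ i $ j) \<le> C ^ n" for n i j
  proof (induction n arbitrary: i j)
    case 0
    show ?case by (simp add: mat_def)
  next
    case (Suc n)
    have "norm (mat_power A (Suc n) $ i $ j)
        \<le> (\<Sum>l\<in>UNIV. norm (A $ i $ l) * norm (mat_power A n $ l $ j))"
      unfolding mat_power.simps matrix_matrix_mult_def vec_lambda_beta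
      by (rule sum_norm_le) (simp add: norm_mult)
    also have "\<dots> \<le> (\<Sum>l\<in>UNIV. norm (A $ i $ l) * C ^ n)"
      by (intro sum_mono mult_left_mono Suc.IH) auto
    also have "\<dots> = (\<Sum>l\<in>UNIV. norm (A $ i $ l)) * C ^ n"
      by (simp add: sum_distrib_right)
    also have "\<dots> \<le> C * C ^ n"
      using row[of i] C0 by (intro mult_right_mono) auto
    finally show ?case by simp
  qed
  have bound: "norm ((1 / fact n) *\<^sub>R mat_power A n)
      \<le> (real CARD('a) * real CARD('a)) * (C ^ n /\<^sub>R fact n)" for n
  proof -
    have "norm (mat_power A n) \<le> (\<Sum>i\<in>UNIV. norm (mat_power A n $ i))"
      by (simp add: norm_vec_def L2_set_le_sum)
    also have "\<dots> \<le> (\<Sum>i\<in>(UNIV::'a set). \<Sum>j\<in>(UNIV::'a set). norm (mat_power A n $ i $ j))"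
      by (intro sum_mono) (simp add: norm_vec_def L2_set_le_sum)
    also have "\<dots> \<le> (\<Sum>i\<in>(UNIV::'a set). \<Sum>j\<in>(UNIV::'a set). C ^ n)"
      by (intro sum_mono entry)
    finally have "norm (mat_power A n) \<le> real CARD('a) * real CARD('a) * C ^ n"
      by (simp add: mult.assoc)
    then have "norm (mat_power A n) / fact n \<le> real CARD('a) * real CARD('a) * C ^ n / fact n"
      by (rule divide_right_mono) simp
    then show ?thesis by (simp add: divide_inverse mult_ac)
  qed
  show ?thesis
    by (rule summable_comparison_test'[OF summable_mult[OF summable_exp_generic[of C]], of 0])
       (use bound in auto)
qed


section \<open>Channels\<close>

definition complex_linear :: "(complex^'a^'a \<Rightarrow> complex^'b^'b) \<Rightarrow> bool" where
  "complex_linear \<Phi> \<longleftrightarrow>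
     (\<forall>X Y. \<Phi> (X + Y) = \<Phi> X + \<Phi> Y) \<and> (\<forall>c X. \<Phi> (cscale c X) = cscale c (\<Phi> X))"

text \<open>
  An operator on the system together with a \<open>k\<close>-dimensional ancilla is a \<open>k \<times> k\<close> block matrix \<open>X\<close>
  of operators on the system, and \<open>id\<^sub>k \<otimes> \<Phi>\<close> applies \<open>\<Phi>\<close> to each block.
\<close>

definition completely_positive :: "(complex^'a^'a \<Rightarrow> complex^'b^'b) \<Rightarrow> bool" where
  "completely_positive \<Phi> \<longleftrightarrow>
     (\<forall>(k::nat) (X :: nat \<Rightarrow> nat \<Rightarrow> complex^'a^'a).
        psd_on ({..<k} \<times> UNIV) (\<lambda>x y. X (fst x) (fst y) $ snd x $ snd y) \<longrightarrow>
        psd_on ({..<k} \<times> UNIV) (\<lambda>x y. \<Phi> (X (fst x) (fst y)) $ snd x $ snd y))"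

definition channel :: "(complex^'a^'a \<Rightarrow> complex^'a^'a) \<Rightarrow> bool" where
  "channel \<Phi> \<longleftrightarrow>
     complex_linear \<Phi> \<and> completely_positive \<Phi> \<and> (\<forall>X. trace (\<Phi> X) = trace X)"


section \<open>Tensor products and marginals\<close>

definition tensor_op :: "('n::finite \<Rightarrow> complex^'d^'d) \<Rightarrow> complex^('n \<Rightarrow> 'd::finite)^('n \<Rightarrow> 'd)" where
  "tensor_op A = (\<chi> f g. \<Prod>i\<in>UNIV. A i $ f i $ g i)"

definition mat_unit :: "'d \<Rightarrow> 'd \<Rightarrow> complex^'d^'d" where
  "mat_unit a b = (\<chi> x y. if x = a \<and> y = b then 1 else 0)"

text \<open>
  The linear map \<open>\<Otimes>\<^sub>i \<Phi> i\<close>, given through the expansion of its argument in the product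
  matrix units \<open>\<Otimes>\<^sub>i |h i\<rangle>\<langle>l i|\<close>.
\<close>

definition tensor_map ::
  "('n::finite \<Rightarrow> complex^'d^'d \<Rightarrow> complex^'d^'d) \<Rightarrow>
     complex^('n \<Rightarrow> 'd::finite)^('n \<Rightarrow> 'd) \<Rightarrow> complex^('n \<Rightarrow> 'd)^('n \<Rightarrow> 'd)" where
  "tensor_map \<Phi> X =
     (\<Sum>h\<in>UNIV. \<Sum>l\<in>UNIV. cscale (X $ h $ l) (tensor_op (\<lambda>i. \<Phi> i (mat_unit (h i) (l i)))))"

definition marginal ::
  "'n::finite \<Rightarrow> complex^('n \<Rightarrow> 'd::finite)^('n \<Rightarrow> 'd) \<Rightarrow> complex^'d^'d" where
  "marginal i \<rho> = (\<chi> a b. \<Sum>f | f i = a. \<rho> $ f $ (f(i := b)))"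

lemma complex_linear_expand:
  fixes \<Phi> :: "complex^'d^'d \<Rightarrow> complex^'d^'d"
  assumes "complex_linear \<Phi>"
  shows "\<Phi> A $ x $ y = (\<Sum>p\<in>UNIV. A $ fst p $ snd p * \<Phi> (mat_unit (fst p) (snd p)) $ x $ y)"
proof -
  have add: "\<Phi> (X + Y) = \<Phi> X + \<Phi> Y" and scale: "\<Phi> (cscale c X) = cscale c (\<Phi> X)" for X Y c
    using assms by (auto simp: complex_linear_def)
  have zero: "\<Phi> 0 = 0"
    using add[of 0 0] by simp
  have sum: "\<Phi> (sum F S) = (\<Sum>s\<in>S. \<Phi> (F s))" if "finite S" for F and S :: "('d \<times> 'd) set"
    using that by (induction S rule: finite_induct) (auto simp: zero add)
  have "A = (\<Sum>p\<in>UNIV. cscale (A $ fst p $ snd p) (mat_unit (fst p) (snd p)))"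
  proof (simp add: vec_eq_iff, intro allI)
    fix i j
    have "(\<Sum>p\<in>UNIV. cscale (A $ fst p $ snd p) (mat_unit (fst p) (snd p)) $ i $ j)
        = (\<Sum>p\<in>UNIV. if (i, j) = p then A $ i $ j else 0)"
      by (intro sum.cong) (auto simp: cscale_def mat_unit_def)
    then show "A $ i $ j
        = (\<Sum>p\<in>UNIV. cscale (A $ fst p $ snd p) (mat_unit (fst p) (snd p)) $ i $ j)"
      by simp
  qed
  then have "\<Phi> A = (\<Sum>p\<in>UNIV. \<Phi> (cscale (A $ fst p $ snd p) (mat_unit (fst p) (snd p))))"
    using sum[of UNIV "\<lambda>p. cscale (A $ fst p $ snd p) (mat_unit (fst p) (snd p))"] by simp
  then show ?thesis
    by (simp add: scale) (simp add: cscale_def)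
qed

lemma tensor_map_tensor_op:
  fixes \<Phi> :: "'n::finite \<Rightarrow> complex^'d::finite^'d \<Rightarrow> complex^'d^'d"
  assumes "\<And>i. complex_linear (\<Phi> i)"
  shows "tensor_map \<Phi> (tensor_op A) = tensor_op (\<lambda>i. \<Phi> i (A i))"
proof -
  have "tensor_map \<Phi> (tensor_op A) $ f $ g = tensor_op (\<lambda>i. \<Phi> i (A i)) $ f $ g" for f g
  proof -
    let ?t = "\<lambda>i p. A i $ fst p $ snd p * \<Phi> i (mat_unit (fst p) (snd p)) $ f i $ g i"
    have bij: "bij_betw (\<lambda>q i. (fst q i, snd q i)) UNIV (UNIV :: ('n \<Rightarrow> 'd \<times> 'd) set)"
      by (rule bij_betwI[where g = "\<lambda>r. (\<lambda>i. fst (r i), \<lambda>i. snd (r i))"]) simp_all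
    have "tensor_op (\<lambda>i. \<Phi> i (A i)) $ f $ g = (\<Prod>i\<in>UNIV. \<Sum>p\<in>UNIV. ?t i p)"
      unfolding tensor_op_def vec_lambda_beta
      by (rule prod.cong[OF refl]) (rule complex_linear_expand[OF assms])
    also have "\<dots> = (\<Sum>r\<in>UNIV. \<Prod>i\<in>UNIV. ?t i (r i))"
      by (subst prod_sum_PiE) (auto simp: PiE_UNIV_domain)
    also have "\<dots> = (\<Sum>q\<in>UNIV. \<Prod>i\<in>UNIV. ?t i (fst q i, snd q i))"
      by (rule sum.reindex_bij_betw[OF bij, symmetric])
    also have "\<dots> = (\<Sum>h\<in>UNIV. \<Sum>l\<in>UNIV. \<Prod>i\<in>UNIV. ?t i (h i, l i))"
      unfolding sum.cartesian_product UNIV_Times_UNIV by (rule sum.cong) (auto split: prod.split)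
    also have "\<dots> = tensor_map \<Phi> (tensor_op A) $ f $ g"
      by (simp add: tensor_map_def cscale_def tensor_op_def prod.distrib)
    finally show ?thesis by simp
  qed
  then show ?thesis by (simp add: vec_eq_iff)
qed

lemma marginal_tensor_op:
  fixes A :: "'n::finite \<Rightarrow> complex^'d::finite^'d"
  assumes "\<And>j. j \<noteq> i \<Longrightarrow> trace (A j) = 1"
  shows "marginal i (tensor_op A) = A i"
proof -
  have "marginal i (tensor_op A) $ a $ b = A i $ a $ b" for a b
  proof -
    let ?B = "\<lambda>j. if j = i then {a} else UNIV"
    let ?F = "\<lambda>j x. if j = i then A i $ a $ b else A j $ x $ x"
    have set: "{f. f i = a} = PiE UNIV ?B" by (auto simp: PiE_def Pi_def split: if_splits)
    have "marginal i (tensor_op A) $ a $ b = (\<Sum>f | f i = a. \<Prod>j\<in>UNIV. ?F j (f j))"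
      by (auto simp: marginal_def tensor_op_def intro!: sum.cong prod.cong)
    also have "\<dots> = (\<Prod>j\<in>UNIV. \<Sum>x\<in>?B j. ?F j x)"
      unfolding set by (rule prod_sum_PiE[symmetric]) auto
    also have "\<dots> = (\<Prod>j\<in>UNIV. if j = i then A i $ a $ b else 1)"
      using assms by (intro prod.cong) (auto simp: trace_def)
    finally show ?thesis by simp
  qed
  then show ?thesis by (simp add: vec_eq_iff)
qed


section \<open>Local thermalizations\<close>

text \<open>
  The shared randomness \<open>\<lambda>\<close> is a real parameter with an arbitrary Borel probability distribution,
  which covers densities, discrete mixtures and, up to isomorphism, all standard Borel spaces.
\<close>

definition local_thermalization ::
  "('n::finite \<Rightarrow> complex^'d^'d) \<Rightarrow>
     (complex^('n \<Rightarrow> 'd::finite)^('n \<Rightarrow> 'd) \<Rightarrow> complex^('n \<Rightarrow> 'd)^('n \<Rightarrow> 'd)) \<Rightarrow> bool" where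
  "local_thermalization \<gamma> E \<longleftrightarrow>
     channel E \<and>
     (\<exists>(M :: real measure) (F :: real \<Rightarrow> 'n \<Rightarrow> complex^'d^'d \<Rightarrow> complex^'d^'d).
        real_distribution M \<and>
        (\<forall>l i. channel (F l i)) \<and>
        (\<forall>X. has_bochner_integral M (\<lambda>l. tensor_map (F l) X) (E X))) \<and>
     (\<forall>\<rho> i. quantum_state \<rho> \<longrightarrow> marginal i (E \<rho>) = \<gamma> i)"


section \<open>Genuine multipartite entanglement\<close>

text \<open>
  The parties in \<open>S\<close> have the product basis \<open>S \<rightarrow>\<^sub>E UNIV\<close>; a basis element \<open>f\<close> of the whole system
  corresponds to the pair of its restrictions to \<open>S\<close> and \<open>- S\<close>.
\<close>

definition product_states :: "'n set \<Rightarrow> (complex^('n::finite \<Rightarrow> 'd::finite)^('n \<Rightarrow> 'd)) set" where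
  "product_states S =
     {\<chi> f g. A (restrict f S) (restrict g S) * B (restrict f (- S)) (restrict g (- S)) | A B.
        density_on (S \<rightarrow>\<^sub>E UNIV) A \<and> density_on ((- S) \<rightarrow>\<^sub>E UNIV) B}"

definition separable_states :: "'n set \<Rightarrow> (complex^('n::finite \<Rightarrow> 'd::finite)^('n \<Rightarrow> 'd)) set" where
  "separable_states S = convex hull (product_states S)"

definition genuinely_multipartite_entangled ::
  "complex^('n::finite \<Rightarrow> 'd::finite)^('n \<Rightarrow> 'd) \<Rightarrow> bool" where
  "genuinely_multipartite_entangled \<rho> \<longleftrightarrow>
     quantum_state \<rho> \<and>
     \<rho> \<notin> convex hull (\<Union>S\<in>{S. S \<noteq> {} \<and> S \<noteq> UNIV}. separable_states S)"

end

theory Submission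
  imports Defs "HOL-Real_Asymp.Real_Asymp"
begin

text \<open>
  Let \<open>z = exp (2 \<pi> i / N)\<close>. Applying the same randomly chosen unitary, \<open>diag (1, z ^ k)\<close> with or
  without a bit flip, to each of the \<open>N\<close> qubits fixes the GHZ state, but turns every local state
  into \<open>1/2\<close>. If each \<open>\<gamma> i\<close> is so close to \<open>1/2\<close> that \<open>\<gamma>' i = 4 \<gamma> i - 3/2\<close> is a state, we perform
  this with probability \<open>3/4\<close> and with probability \<open>1/4\<close> replace everything by the product of the
  \<open>\<gamma>' i\<close>. The marginals are then \<open>3/4 \<cdot> 1/2 + 1/4 \<gamma>' i = \<gamma> i\<close>, and the GHZ state is sent to a state
  whose fidelity with it is at least \<open>3/4\<close>, whereas biseparable states have fidelity at most \<open>1/2\<close>.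
  For high temperatures the thermal states are close to \<open>1/2\<close>.
\<close>

section \<open>Maps in Kraus form\<close>

lemma sum_swap_pairs:
  "(\<Sum>x\<in>A. \<Sum>y\<in>B. \<Sum>a\<in>C. \<Sum>b\<in>D. t x y a b) = (\<Sum>a\<in>C. \<Sum>b\<in>D. \<Sum>x\<in>A. \<Sum>y\<in>B. t x y a b)"
proof -
  have "(\<Sum>x\<in>A. \<Sum>y\<in>B. \<Sum>a\<in>C. \<Sum>b\<in>D. t x y a b) = (\<Sum>x\<in>A. \<Sum>a\<in>C. \<Sum>y\<in>B. \<Sum>b\<in>D. t x y a b)"
    by (rule sum.cong[OF refl], rule sum.swap)
  also have "\<dots> = (\<Sum>a\<in>C. \<Sum>x\<in>A. \<Sum>y\<in>B. \<Sum>b\<in>D. t x y a b)"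
    by (rule sum.swap)
  also have "\<dots> = (\<Sum>a\<in>C. \<Sum>x\<in>A. \<Sum>b\<in>D. \<Sum>y\<in>B. t x y a b)"
    by (rule sum.cong[OF refl], rule sum.cong[OF refl], rule sum.swap)
  also have "\<dots> = (\<Sum>a\<in>C. \<Sum>b\<in>D. \<Sum>x\<in>A. \<Sum>y\<in>B. t x y a b)"
    by (rule sum.cong[OF refl], rule sum.swap)
  finally show ?thesis .
qed

text \<open>The form of \<open>L A L'\<close> at \<open>v\<close>, where \<open>L'\<close> is the
  adjoint of \<open>L\<close>, is the form of \<open>A\<close> at \<open>w = L' v\<close>.
  \<open>L\<close> may be rectangular.\<close>

lemma psd_on_congruence:
  assumes "psd_on I A"
  shows "psd_on I' (\<lambda>x y. \<Sum>a\<in>I. \<Sum>b\<in>I. L x a * A a b * cnj (L y b))"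
  unfolding psd_on_def
proof
  fix v
  define w where "w a = (\<Sum>x\<in>I'. cnj (L x a) * v x)" for a
  have "(\<Sum>x\<in>I'. \<Sum>y\<in>I'. cnj (v x) * (\<Sum>a\<in>I. \<Sum>b\<in>I. L x a * A a b * cnj (L y b)) * v y)
      = (\<Sum>x\<in>I'. \<Sum>y\<in>I'. \<Sum>a\<in>I. \<Sum>b\<in>I. cnj (v x) * L x a * A a b * cnj (L y b) * v y)"
    by (simp add: sum_distrib_left sum_distrib_right mult.assoc)
  also have "\<dots> = (\<Sum>a\<in>I. \<Sum>b\<in>I. \<Sum>x\<in>I'. \<Sum>y\<in>I'. cnj (v x) * L x a * A a b * cnj (L y b) * v y)"
    by (rule sum_swap_pairs)
  also have "\<dots> = (\<Sum>a\<in>I. \<Sum>b\<in>I. cnj (w a) * A a b * w b)"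
    by (intro sum.cong refl) (simp add: w_def sum_distrib_left sum_distrib_right mult_ac)
  also have "\<dots> \<in> \<real>\<^sub>\<ge>\<^sub>0"
    using assms unfolding psd_on_def by blast
  finally show "(\<Sum>x\<in>I'. \<Sum>y\<in>I'.
      cnj (v x) * (\<Sum>a\<in>I. \<Sum>b\<in>I. L x a * A a b * cnj (L y b)) * v y) \<in> \<real>\<^sub>\<ge>\<^sub>0" .
qed

lemma sum_nonneg_Reals:
  fixes f :: "'s \<Rightarrow> complex"
  assumes "\<And>s. s \<in> S \<Longrightarrow> f s \<in> \<real>\<^sub>\<ge>\<^sub>0"
  shows "sum f S \<in> \<real>\<^sub>\<ge>\<^sub>0"
  using assms by (simp add: complex_nonneg_Reals_iff sum_nonneg)

lemma psd_on_sum: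
  assumes "\<And>s. s \<in> S \<Longrightarrow> psd_on I (A s)"
  shows "psd_on I (\<lambda>x y. \<Sum>s\<in>S. A s x y)"
  unfolding psd_on_def
proof
  fix v
  have "(\<Sum>x\<in>I. \<Sum>y\<in>I. cnj (v x) * (\<Sum>s\<in>S. A s x y) * v y)
      = (\<Sum>x\<in>I. \<Sum>y\<in>I. \<Sum>s\<in>S. cnj (v x) * A s x y * v y)"
    by (simp add: sum_distrib_left sum_distrib_right)
  also have "\<dots> = (\<Sum>x\<in>I. \<Sum>s\<in>S. \<Sum>y\<in>I. cnj (v x) * A s x y * v y)"
    by (rule sum.cong[OF refl], rule sum.swap)
  also have "\<dots> = (\<Sum>s\<in>S. \<Sum>x\<in>I. \<Sum>y\<in>I. cnj (v x) * A s x y * v y)"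
    by (rule sum.swap)
  also have "\<dots> \<in> \<real>\<^sub>\<ge>\<^sub>0"
    using assms unfolding psd_on_def by (blast intro: sum_nonneg_Reals)
  finally show "(\<Sum>x\<in>I. \<Sum>y\<in>I. cnj (v x) * (\<Sum>s\<in>S. A s x y) * v y) \<in> \<real>\<^sub>\<ge>\<^sub>0" .
qed

lemma psd_on_scale:
  assumes "psd_on I A" and "r \<ge> 0"
  shows "psd_on I (\<lambda>x y. complex_of_real r * A x y)"
  unfolding psd_on_def
proof
  fix v
  have "(\<Sum>x\<in>I. \<Sum>y\<in>I. cnj (v x) * (complex_of_real r * A x y) * v y)
      = complex_of_real r * (\<Sum>x\<in>I. \<Sum>y\<in>I. cnj (v x) * A x y * v y)"
    by (simp add: sum_distrib_left mult_ac)
  also have "\<dots> \<in> \<real>\<^sub>\<ge>\<^sub>0"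
    using assms by (auto simp: psd_on_def complex_nonneg_Reals_iff)
  finally show "(\<Sum>x\<in>I. \<Sum>y\<in>I. cnj (v x) * (complex_of_real r * A x y) * v y) \<in> \<real>\<^sub>\<ge>\<^sub>0" .
qed

text \<open>All local maps used below are given in this form: linearity and complete positivity are
  then automatic, and only the trace condition remains to be checked.\<close>

definition kraus :: "'j set \<Rightarrow> ('j \<Rightarrow> complex^'a^'b) \<Rightarrow> complex^'a^'a \<Rightarrow> complex^'b^'b" where
  "kraus J K X = (\<chi> x y. \<Sum>j\<in>J. \<Sum>a\<in>UNIV. \<Sum>b\<in>UNIV. K j $ x $ a * X $ a $ b * cnj (K j $ y $ b))"

lemma complex_linear_kraus: "complex_linear (kraus J K)"
  by (simp add: complex_linear_def kraus_def cscale_def vec_eq_iff algebra_simps sum.distrib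
      sum_distrib_left)

lemma sum_delta_pair:
  fixes t :: "'m \<times> 'a::finite \<Rightarrow> 'c::comm_monoid_add"
  assumes "finite A" and "m \<in> A"
  shows "(\<Sum>p\<in>A \<times> UNIV. if fst p = m then t p else 0) = (\<Sum>a\<in>UNIV. t (m, a))"
proof -
  have "(\<Sum>p\<in>A \<times> UNIV. if fst p = m then t p else 0)
      = (\<Sum>m'\<in>A. \<Sum>a\<in>UNIV. if m' = m then t (m', a) else 0)"
    unfolding sum.cartesian_product by (intro sum.cong) auto
  also have "\<dots> = (\<Sum>m'\<in>A. if m' = m then \<Sum>a\<in>UNIV. t (m', a) else 0)"
    by (intro sum.cong) auto
  also have "\<dots> = (\<Sum>a\<in>UNIV. t (m, a))"
    using assms by simp
  finally show ?thesis .
qed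

lemma completely_positive_kraus:
  fixes K :: "'j \<Rightarrow> complex^'a::finite^'b::finite"
  shows "completely_positive (kraus J K)"
  unfolding completely_positive_def
proof (intro allI impI)
  fix k :: nat and X :: "nat \<Rightarrow> nat \<Rightarrow> complex^'a^'a"
  let ?I = "{..<k} \<times> (UNIV :: 'a set)" and ?I' = "{..<k} \<times> (UNIV :: 'b set)"
  let ?X = "\<lambda>p q. X (fst p) (fst q) $ snd p $ snd q"
  \<comment> \<open>\<open>L j\<close> is the matrix of \<open>1 \<otimes> K j\<close> on ancilla
    and system, so that \<open>id \<otimes> kraus J K\<close> is a sum of congruences by the
    \<open>L j\<close>.\<close>
  define L where "L j p q = (if fst q = fst p then K j $ snd p $ snd q else 0)"
    for j and p :: "nat \<times> 'b" and q :: "nat \<times> 'a"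
  assume "psd_on ?I ?X"
  then have *: "psd_on ?I' (\<lambda>p q. \<Sum>j\<in>J. \<Sum>a\<in>?I. \<Sum>b\<in>?I. L j p a * ?X a b * cnj (L j q b))"
    by (intro psd_on_sum psd_on_congruence)
  have eq: "(\<Sum>a\<in>?I. \<Sum>b\<in>?I. L j p a * ?X a b * cnj (L j q b))
      = (\<Sum>a\<in>UNIV. \<Sum>b\<in>UNIV. K j $ snd p $ a * X (fst p) (fst q) $ a $ b * cnj (K j $ snd q $ b))"
    if "p \<in> ?I'" and "q \<in> ?I'" for j p q
  proof -
    have "(\<Sum>a\<in>?I. \<Sum>b\<in>?I. L j p a * ?X a b * cnj (L j q b))
        = (\<Sum>a\<in>?I. if fst a = fst p then \<Sum>b\<in>?I. if fst b = fst q
              then K j $ snd p $ snd a * ?X a b * cnj (K j $ snd q $ snd b) else 0 else 0)"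
      by (intro sum.cong refl) (auto simp: L_def intro!: sum.cong)
    also have "\<dots> = (\<Sum>a\<in>UNIV. \<Sum>b\<in>UNIV.
        K j $ snd p $ a * X (fst p) (fst q) $ a $ b * cnj (K j $ snd q $ b))"
      using that by (subst sum_delta_pair, simp, force, subst sum_delta_pair) auto
    finally show ?thesis .
  qed
  have form: "(\<Sum>p\<in>?I'. \<Sum>q\<in>?I'. cnj (v p) *
        (\<Sum>j\<in>J. \<Sum>a\<in>?I. \<Sum>b\<in>?I. L j p a * ?X a b * cnj (L j q b)) * v q)
     = (\<Sum>p\<in>?I'. \<Sum>q\<in>?I'. cnj (v p) * kraus J K (X (fst p) (fst q)) $ snd p $ snd q * v q)" for v
    by (intro sum.cong refl) (simp only: eq kraus_def vec_lambda_beta)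
  show "psd_on ?I' (\<lambda>p q. kraus J K (X (fst p) (fst q)) $ snd p $ snd q)"
    using * unfolding psd_on_def form .
qed

lemma kraus_mat_unit:
  "kraus J K (mat_unit a b) $ x $ y = (\<Sum>j\<in>J. K j $ x $ a * cnj (K j $ y $ b))"
proof -
  have "(\<Sum>c\<in>UNIV. \<Sum>d\<in>UNIV. K j $ x $ c * mat_unit a b $ c $ d * cnj (K j $ y $ d))
      = K j $ x $ a * cnj (K j $ y $ b)" for j
  proof -
    have "(\<Sum>c\<in>UNIV. \<Sum>d\<in>UNIV. K j $ x $ c * mat_unit a b $ c $ d * cnj (K j $ y $ d))
        = (\<Sum>c\<in>UNIV. \<Sum>d\<in>UNIV. if d = b then if c = a then K j $ x $ c * cnj (K j $ y $ d) else 0 else 0)"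
      by (intro sum.cong refl) (auto simp: mat_unit_def)
    then show ?thesis by simp
  qed
  then show ?thesis by (simp add: kraus_def)
qed

text \<open>The hypothesis is the completeness relation: the products of the adjoint of
  \<open>K j\<close> with \<open>K j\<close> sum to the identity.\<close>

lemma trace_kraus:
  assumes "\<And>a b. (\<Sum>j\<in>J. \<Sum>x\<in>UNIV. K j $ x $ a * cnj (K j $ x $ b)) = (if a = b then 1 else 0)"
  shows "trace (kraus J K X) = trace X"
proof -
  have "trace (kraus J K X)
      = (\<Sum>x\<in>UNIV. \<Sum>j\<in>J. \<Sum>a\<in>UNIV. \<Sum>b\<in>UNIV. K j $ x $ a * X $ a $ b * cnj (K j $ x $ b))"
    by (simp add: trace_def kraus_def)
  also have "\<dots> = (\<Sum>a\<in>UNIV. \<Sum>b\<in>UNIV. \<Sum>x\<in>UNIV. \<Sum>j\<in>J. K j $ x $ a * X $ a $ b * cnj (K j $ x $ b))"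
    by (rule sum_swap_pairs)
  also have "\<dots> = (\<Sum>a\<in>UNIV. \<Sum>b\<in>UNIV. \<Sum>j\<in>J. \<Sum>x\<in>UNIV. K j $ x $ a * X $ a $ b * cnj (K j $ x $ b))"
    by (rule sum.cong[OF refl], rule sum.cong[OF refl], rule sum.swap)
  also have "\<dots> = (\<Sum>a\<in>UNIV. \<Sum>b\<in>UNIV.
      X $ a $ b * (\<Sum>j\<in>J. \<Sum>x\<in>UNIV. K j $ x $ a * cnj (K j $ x $ b)))"
    by (intro sum.cong refl) (simp add: sum_distrib_left mult_ac)
  also have "\<dots> = trace X"
    unfolding assms by (simp add: trace_def if_distrib cong: if_cong)
  finally show ?thesis .
qed

text \<open>Multiplying out the product over the parties of their Kraus sums leaves one term for
  each choice \<open>\<kappa>\<close> of an index per party. This yields complete positivity of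
  product maps and lets them be evaluated on the GHZ state.\<close>

lemma tensor_map_kraus:
  fixes K :: "'n::finite \<Rightarrow> 'j \<Rightarrow> complex^'d::finite^'d"
  assumes "\<And>i. finite (J i)"
  shows "tensor_map (\<lambda>i. kraus (J i) (K i)) = kraus (PiE UNIV J) (\<lambda>\<kappa>. tensor_op (\<lambda>i. K i (\<kappa> i)))"
proof
  fix X :: "complex^('n \<Rightarrow> 'd)^('n \<Rightarrow> 'd)"
  let ?P = "\<lambda>\<kappa>. tensor_op (\<lambda>i. K i (\<kappa> i))"
  have "tensor_map (\<lambda>i. kraus (J i) (K i)) X $ f $ g = kraus (PiE UNIV J) ?P X $ f $ g" for f g
  proof -
    have "tensor_map (\<lambda>i. kraus (J i) (K i)) X $ f $ g
        = (\<Sum>h\<in>UNIV. \<Sum>l\<in>UNIV. X $ h $ l *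
             (\<Prod>i\<in>UNIV. \<Sum>j\<in>J i. K i j $ f i $ h i * cnj (K i j $ g i $ l i)))"
      by (simp add: tensor_map_def cscale_def tensor_op_def kraus_mat_unit)
    also have "\<dots> = (\<Sum>h\<in>UNIV. \<Sum>l\<in>UNIV. \<Sum>\<kappa>\<in>PiE UNIV J. ?P \<kappa> $ f $ h * X $ h $ l * cnj (?P \<kappa> $ g $ l))"
      using assms by (intro sum.cong refl, subst prod_sum_PiE)
        (auto simp: tensor_op_def prod.distrib sum_distrib_left mult_ac)
    also have "\<dots> = (\<Sum>h\<in>UNIV. \<Sum>\<kappa>\<in>PiE UNIV J. \<Sum>l\<in>UNIV. ?P \<kappa> $ f $ h * X $ h $ l * cnj (?P \<kappa> $ g $ l))"
      by (rule sum.cong[OF refl], rule sum.swap)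
    also have "\<dots> = (\<Sum>\<kappa>\<in>PiE UNIV J. \<Sum>h\<in>UNIV. \<Sum>l\<in>UNIV. ?P \<kappa> $ f $ h * X $ h $ l * cnj (?P \<kappa> $ g $ l))"
      by (rule sum.swap)
    finally show ?thesis by (simp add: kraus_def)
  qed
  then show "tensor_map (\<lambda>i. kraus (J i) (K i)) X = kraus (PiE UNIV J) ?P X"
    by (simp add: vec_eq_iff)
qed


section \<open>Marginals of product maps\<close>

lemma trace_marginal:
  fixes X :: "complex^('n::finite \<Rightarrow> 'd::finite)^('n \<Rightarrow> 'd)"
  shows "trace (marginal i X) = trace X"
proof -
  have "trace (marginal i X) = (\<Sum>a\<in>UNIV. \<Sum>f | f i = a. X $ f $ f)"
    by (auto simp: trace_def marginal_def intro!: sum.cong)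
  also have "\<dots> = trace X"
    using sum.group[of "UNIV :: ('n \<Rightarrow> 'd) set" UNIV "\<lambda>f. f i" "\<lambda>f. X $ f $ f"]
    by (simp add: trace_def)
  finally show ?thesis .
qed

text \<open>The traces are kept because \<open>tensor_map\<close> expands into factors
  \<open>\<Phi> j (mat_unit p q)\<close>, whose trace can vanish.\<close>

lemma marginal_tensor_op_scaled:
  fixes A :: "'n::finite \<Rightarrow> complex^'d::finite^'d"
  shows "marginal i (tensor_op A) = cscale (\<Prod>j\<in>UNIV-{i}. trace (A j)) (A i)"
proof -
  have "marginal i (tensor_op A) $ a $ b = (\<Prod>j\<in>UNIV-{i}. trace (A j)) * A i $ a $ b" for a b
  proof -
    let ?B = "\<lambda>j. if j = i then {a} else UNIV"
    \<comment> \<open>With coordinate \<open>i\<close> pinned to \<open>a\<close>, the factor at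
      \<open>i\<close> is constant, so the sum over \<open>f\<close> splits into a product of
      one-party sums.\<close>
    let ?F = "\<lambda>j x. if j = i then A i $ a $ b else A j $ x $ x"
    have set: "{f. f i = a} = PiE UNIV ?B" by (auto simp: PiE_def Pi_def split: if_splits)
    have "marginal i (tensor_op A) $ a $ b = (\<Sum>f | f i = a. \<Prod>j\<in>UNIV. ?F j (f j))"
      by (auto simp: marginal_def tensor_op_def intro!: sum.cong prod.cong)
    also have "\<dots> = (\<Prod>j\<in>UNIV. \<Sum>x\<in>?B j. ?F j x)"
      unfolding set by (rule prod_sum_PiE[symmetric]) auto
    also have "\<dots> = (\<Prod>j\<in>UNIV. if j = i then A i $ a $ b else trace (A j))"
      by (intro prod.cong) (auto simp: trace_def)
    also have "\<dots> = A i $ a $ b * (\<Prod>j\<in>UNIV-{i}. trace (A j))"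
      by (subst prod.remove[of _ i]) (auto intro!: prod.cong)
    finally show ?thesis by (simp add: mult.commute)
  qed
  then show ?thesis by (simp add: vec_eq_iff cscale_def)
qed

text \<open>A trace-preserving map on a party that is traced out leaves no mark, so only the channel
  of party \<open>i\<close> acts on the marginal.\<close>

lemma marginal_tensor_map:
  fixes \<Phi> :: "'n::finite \<Rightarrow> complex^'d::finite^'d \<Rightarrow> complex^'d^'d"
  assumes lin: "complex_linear (\<Phi> i)" and tr: "\<And>j X. trace (\<Phi> j X) = trace X"
  shows "marginal i (tensor_map \<Phi> X) = \<Phi> i (marginal i X)"
proof -
  have "marginal i (tensor_map \<Phi> X) $ a $ b = \<Phi> i (marginal i X) $ a $ b" for a b
  proof -
    let ?T = "\<lambda>h l. tensor_op (\<lambda>j. \<Phi> j (mat_unit (h j) (l j)))"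
    let ?c = "\<lambda>p q. \<Phi> i (mat_unit p q) $ a $ b"
    have trm: "trace (mat_unit p q :: complex^'d^'d) = (if p = q then 1 else 0)" for p q
    proof -
      have "trace (mat_unit p q :: complex^'d^'d) = (\<Sum>x\<in>UNIV. if x = p then if p = q then 1 else 0 else 0)"
        unfolding trace_def by (intro sum.cong) (auto simp: mat_unit_def)
      then show ?thesis by simp
    qed
    \<comment> \<open>Trace preservation reduces the factors of the other parties to traces of
      matrix units, which vanish unless \<open>h\<close> and \<open>l\<close> agree away from
      \<open>i\<close>.\<close>
    have prod01: "(\<Prod>j\<in>UNIV-{i}. trace (\<Phi> j (mat_unit (h j) (l j))))
        = (if \<forall>j. j \<noteq> i \<longrightarrow> h j = l j then 1 else 0)" for h l
      unfolding tr trm by auto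
    have inner: "(\<Sum>l\<in>UNIV. X $ h $ l * marginal i (?T h l) $ a $ b)
        = (\<Sum>q\<in>UNIV. X $ h $ (h(i := q)) * ?c (h i) q)" for h
    proof -
      \<comment> \<open>The surviving \<open>l\<close> differ from \<open>h\<close> at most in
        coordinate \<open>i\<close>, and \<open>q\<close> is their value there.\<close>
      have set: "{l. \<forall>j. j \<noteq> i \<longrightarrow> h j = l j} = range (\<lambda>q. h(i := q))"
        by (auto simp: image_iff fun_eq_iff)
      have inj: "inj (\<lambda>q. h(i := q))"
        by (auto simp: inj_on_def dest: fun_upd_eqD)
      have "(\<Sum>l\<in>UNIV. X $ h $ l * marginal i (?T h l) $ a $ b)
          = (\<Sum>l\<in>{l. \<forall>j. j \<noteq> i \<longrightarrow> h j = l j}. X $ h $ l * ?c (h i) (l i))"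
        by (intro sum.mono_neutral_cong_right)
          (auto simp: marginal_tensor_op_scaled prod01 cscale_def)
      also have "\<dots> = (\<Sum>q\<in>UNIV. X $ h $ (h(i := q)) * ?c (h i) q)"
        unfolding set by (simp add: sum.reindex[OF inj])
      finally show ?thesis .
    qed
    have "marginal i (tensor_map \<Phi> X) $ a $ b
        = (\<Sum>f | f i = a. \<Sum>h\<in>UNIV. \<Sum>l\<in>UNIV. X $ h $ l * ?T h l $ f $ (f(i := b)))"
      by (simp add: marginal_def tensor_map_def cscale_def)
    also have "\<dots> = (\<Sum>h\<in>UNIV. \<Sum>f | f i = a. \<Sum>l\<in>UNIV. X $ h $ l * ?T h l $ f $ (f(i := b)))"
      by (rule sum.swap)
    also have "\<dots> = (\<Sum>h\<in>UNIV. \<Sum>l\<in>UNIV. \<Sum>f | f i = a. X $ h $ l * ?T h l $ f $ (f(i := b)))"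
      by (rule sum.cong[OF refl], rule sum.swap)
    also have "\<dots> = (\<Sum>h\<in>UNIV. \<Sum>l\<in>UNIV. X $ h $ l * marginal i (?T h l) $ a $ b)"
      by (simp add: marginal_def sum_distrib_left)
    also have "\<dots> = (\<Sum>h\<in>UNIV. \<Sum>q\<in>UNIV. X $ h $ (h(i := q)) * ?c (h i) q)"
      unfolding inner ..
    also have "\<dots> = (\<Sum>p\<in>UNIV. \<Sum>h | h i = p. \<Sum>q\<in>UNIV. X $ h $ (h(i := q)) * ?c (h i) q)"
      using sum.group[of "UNIV :: ('n \<Rightarrow> 'd) set" UNIV "\<lambda>f. f i"
          "\<lambda>h. \<Sum>q\<in>UNIV. X $ h $ (h(i := q)) * ?c (h i) q"] by simp
    also have "\<dots> = (\<Sum>p\<in>UNIV. \<Sum>q\<in>UNIV. \<Sum>h | h i = p. X $ h $ (h(i := q)) * ?c (h i) q)"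
      by (rule sum.cong[OF refl], rule sum.swap)
    also have "\<dots> = (\<Sum>p\<in>UNIV. \<Sum>q\<in>UNIV. marginal i X $ p $ q * ?c p q)"
      by (intro sum.cong refl) (simp add: marginal_def sum_distrib_right)
    also have "\<dots> = \<Phi> i (marginal i X) $ a $ b"
      unfolding complex_linear_expand[OF lin, of "marginal i X"]
      by (simp add: sum.cartesian_product case_prod_beta)
    finally show ?thesis .
  qed
  then show ?thesis by (simp add: vec_eq_iff)
qed


section \<open>Uniform mixtures of product channels\<close>

lemma channel_tensor_map_kraus:
  fixes K :: "'n::finite \<Rightarrow> 'j \<Rightarrow> complex^'d::finite^'d"
  assumes "\<And>i. finite (J i)" and tr: "\<And>i X. trace (kraus (J i) (K i) X) = trace X"
  shows "channel (tensor_map (\<lambda>i. kraus (J i) (K i)))"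
proof -
  have "trace (tensor_map (\<lambda>i. kraus (J i) (K i)) X) = trace X" for X
  proof -
    \<comment> \<open>Any party serves: the trace is that of the marginal at \<open>i\<close>, on
      which the product map acts as the trace-preserving local map.\<close>
    fix i :: 'n
    show ?thesis
      using marginal_tensor_map[of "\<lambda>i. kraus (J i) (K i)" i X, OF complex_linear_kraus tr]
        trace_marginal[of i X] trace_marginal[of i "tensor_map (\<lambda>i. kraus (J i) (K i)) X"] tr
      by metis
  qed
  then show ?thesis
    using assms by (simp add: channel_def tensor_map_kraus complex_linear_kraus completely_positive_kraus)
qed

lemma scaleR_entry:
  fixes A :: "complex^'a^'b"
  shows "(r *\<^sub>R A) $ i $ j = complex_of_real r * A $ i $ j"
  unfolding vector_scaleR_component by (rule scaleR_conv_of_real)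

lemma channel_uniform_mixture:
  fixes \<Phi> :: "'s \<Rightarrow> complex^'a::finite^'a \<Rightarrow> complex^'a^'a"
  assumes "finite S" and "S \<noteq> {}" and ch: "\<And>s. s \<in> S \<Longrightarrow> channel (\<Phi> s)"
  shows "channel (\<lambda>X. (1 / real (card S)) *\<^sub>R (\<Sum>s\<in>S. \<Phi> s X))"
  unfolding channel_def
proof (intro conjI allI)
  let ?r = "1 / real (card S)"
  show "complex_linear (\<lambda>X. ?r *\<^sub>R (\<Sum>s\<in>S. \<Phi> s X))"
    unfolding complex_linear_def
  proof (intro conjI allI)
    fix c and X Y :: "complex^'a^'a"
    have lin: "\<Phi> s (X + Y) = \<Phi> s X + \<Phi> s Y" "\<Phi> s (cscale c X) = cscale c (\<Phi> s X)" if "s \<in> S" for s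
      using ch[OF that] by (simp_all add: channel_def complex_linear_def)
    show "?r *\<^sub>R (\<Sum>s\<in>S. \<Phi> s (X + Y)) = ?r *\<^sub>R (\<Sum>s\<in>S. \<Phi> s X) + ?r *\<^sub>R (\<Sum>s\<in>S. \<Phi> s Y)"
      by (simp add: lin sum.distrib scaleR_add_right)
    have "(\<Sum>s\<in>S. \<Phi> s (cscale c X)) = cscale c (\<Sum>s\<in>S. \<Phi> s X)"
      by (simp add: lin) (simp add: cscale_def vec_eq_iff sum_distrib_left)
    then show "?r *\<^sub>R (\<Sum>s\<in>S. \<Phi> s (cscale c X)) = cscale c (?r *\<^sub>R (\<Sum>s\<in>S. \<Phi> s X))"
      by (simp add: cscale_def vec_eq_iff)
  qed
  show "completely_positive (\<lambda>X. ?r *\<^sub>R (\<Sum>s\<in>S. \<Phi> s X))"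
    unfolding completely_positive_def
  proof (intro allI impI)
    fix k :: nat and X :: "nat \<Rightarrow> nat \<Rightarrow> complex^'a^'a"
    assume X: "psd_on ({..<k} \<times> UNIV) (\<lambda>x y. X (fst x) (fst y) $ snd x $ snd y)"
    have "psd_on ({..<k} \<times> UNIV) (\<lambda>x y. complex_of_real ?r *
        (\<Sum>s\<in>S. \<Phi> s (X (fst x) (fst y)) $ snd x $ snd y))"
      using ch X by (intro psd_on_scale psd_on_sum) (auto simp: channel_def completely_positive_def)
    then show "psd_on ({..<k} \<times> UNIV)
        (\<lambda>x y. (?r *\<^sub>R (\<Sum>s\<in>S. \<Phi> s (X (fst x) (fst y)))) $ snd x $ snd y)"
      by (simp add: scaleR_entry del: vector_scaleR_component)
  qed
  fix X :: "complex^'a^'a"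
  have "trace (?r *\<^sub>R (\<Sum>s\<in>S. \<Phi> s X)) = complex_of_real ?r * (\<Sum>s\<in>S. trace (\<Phi> s X))"
    unfolding trace_def scaleR_entry sum_component sum_distrib_left[symmetric]
    by (subst sum.swap) (rule refl)
  also have "\<dots> = complex_of_real ?r * (\<Sum>s\<in>S. trace X)"
    using ch by (simp add: channel_def)
  also have "\<dots> = trace X"
    using assms by simp
  finally show "trace (?r *\<^sub>R (\<Sum>s\<in>S. \<Phi> s X)) = trace X" .
qed

text \<open>As marginals commute with product channels, thermalization only requires that the
  averaged local channel of each party sends every operator of trace 1 to
  \<open>\<gamma> i\<close>.\<close>

lemma local_thermalization_uniform_mixture:
  fixes F :: "'s::countable \<Rightarrow> 'n::finite \<Rightarrow> complex^'d::finite^'d \<Rightarrow> complex^'d^'d"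
  assumes S: "finite S" "S \<noteq> {}"
    and ch: "\<And>s i. channel (F s i)" and tch: "\<And>s. channel (tensor_map (F s))"
    and avg: "\<And>i X. trace X = 1 \<Longrightarrow> (1 / real (card S)) *\<^sub>R (\<Sum>s\<in>S. F s i X) = \<gamma> i"
  shows "local_thermalization \<gamma> (\<lambda>X. (1 / real (card S)) *\<^sub>R (\<Sum>s\<in>S. tensor_map (F s) X))"
proof -
  define E where "E X = (1 / real (card S)) *\<^sub>R (\<Sum>s\<in>S. tensor_map (F s) X)" for X
  \<comment> \<open>The finite index set is carried into the reals by \<open>to_nat\<close>.
    Decoding through the floor makes \<open>G\<close> factor through a discrete space, hence
    measurable, and \<open>G l\<close> consists of channels for every real \<open>l\<close> since
    \<open>F s\<close> does for every \<open>s\<close>.\<close>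
  define M where "M = distr (measure_pmf (pmf_of_set S)) borel (\<lambda>s. real (to_nat s))"
  define G where "G l = F (from_nat (nat \<lfloor>l\<rfloor>))" for l :: real
  interpret D: prob_space M
    unfolding M_def by (intro measure_pmf.prob_space_distr) simp
  have M: "real_distribution M"
    by unfold_locales (simp_all add: M_def)
  have int: "has_bochner_integral M (\<lambda>l. tensor_map (G l) X) (E X)" for X
  proof -
    have "integrable (measure_pmf (pmf_of_set S)) (\<lambda>s. tensor_map (F s) X)"
      using S by (intro integrable_measure_pmf_finite) simp
    moreover have "(\<integral>s. tensor_map (F s) X \<partial>measure_pmf (pmf_of_set S)) = E X"
      using S by (subst integral_measure_pmf[of S])
        (auto simp: E_def scaleR_sum_right intro!: sum.cong)
    ultimately have *: "has_bochner_integral (measure_pmf (pmf_of_set S)) (\<lambda>s. tensor_map (F s) X) (E X)"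
      by (simp add: has_bochner_integral_iff)
    have meas: "(\<lambda>l::real. tensor_map (G l) X) \<in> borel_measurable borel"
      unfolding G_def
      by (rule measurable_compose[where N = "count_space UNIV" and f = floor
            and g = "\<lambda>m. tensor_map (F (from_nat (nat m))) X"]) simp_all
    show ?thesis
      unfolding M_def using * by (intro has_bochner_integral_distr meas) (simp_all add: G_def)
  qed
  have marg: "marginal i (E \<rho>) = \<gamma> i" if "quantum_state \<rho>" for \<rho> i
  proof -
    have "trace \<rho> = 1"
      using that by (simp add: quantum_state_def density_on_def trace_def)
    then have t: "trace (marginal i \<rho>) = 1"
      by (simp add: trace_marginal)
    have "marginal i (E \<rho>) = (1 / real (card S)) *\<^sub>R (\<Sum>s\<in>S. marginal i (tensor_map (F s) \<rho>))"
      unfolding E_def marginal_def vec_eq_iff scaleR_entry sum_component vec_lambda_beta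
        sum_distrib_left[symmetric]
      by (intro allI arg_cong2[where f = "(*)"] refl sum.swap)
    also have "\<dots> = (1 / real (card S)) *\<^sub>R (\<Sum>s\<in>S. F s i (marginal i \<rho>))"
      using ch by (simp add: marginal_tensor_map channel_def)
    also have "\<dots> = \<gamma> i"
      by (rule avg[OF t])
    finally show ?thesis .
  qed
  have "channel E"
    unfolding E_def[abs_def] by (intro channel_uniform_mixture S tch)
  moreover have "\<forall>l i. channel (G l i)"
    by (simp add: G_def ch)
  ultimately have "local_thermalization \<gamma> E"
    unfolding local_thermalization_def using M int marg by blast
  then show ?thesis
    by (simp add: E_def[abs_def])
qed

section \<open>Channels preserve states\<close>

lemma sum_singleton_Times:
  fixes f :: "nat \<times> 'a::finite \<Rightarrow> 'c::comm_monoid_add"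
  shows "(\<Sum>p\<in>{..<1} \<times> UNIV. f p) = (\<Sum>x\<in>UNIV. f (0, x))"
proof -
  have "{..<1::nat} \<times> (UNIV :: 'a set) = Pair 0 ` UNIV" by auto
  then show ?thesis by (simp add: sum.reindex inj_on_def)
qed

text \<open>An ancilla of dimension 1 turns complete positivity into positivity.\<close>

lemma completely_positive_psd:
  fixes \<Phi> :: "complex^'a::finite^'a \<Rightarrow> complex^'b::finite^'b"
  assumes cp: "completely_positive \<Phi>" and X: "psd_on UNIV (\<lambda>x y. X $ x $ y)"
  shows "psd_on UNIV (\<lambda>x y. \<Phi> X $ x $ y)"
proof -
  have "psd_on ({..<1::nat} \<times> UNIV) (\<lambda>x y. X $ snd x $ snd y)"
    using X unfolding psd_on_def sum_singleton_Times by simp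
  with cp have "psd_on ({..<1::nat} \<times> UNIV) (\<lambda>x y. \<Phi> X $ snd x $ snd y)"
    unfolding completely_positive_def by (elim allE[of _ 1] allE[of _ "\<lambda>_ _. X"]) simp
  then have "(\<Sum>x\<in>UNIV. \<Sum>y\<in>UNIV. cnj (v x) * \<Phi> X $ x $ y * v y) \<in> \<real>\<^sub>\<ge>\<^sub>0" for v
    unfolding psd_on_def sum_singleton_Times by (elim allE[of _ "\<lambda>p. v (snd p)"]) simp
  then show ?thesis
    by (simp add: psd_on_def)
qed

lemma channel_quantum_state:
  assumes "channel \<Phi>" and "quantum_state \<rho>"
  shows "quantum_state (\<Phi> \<rho>)"
proof -
  have "psd_on UNIV (\<lambda>x y. \<Phi> \<rho> $ x $ y)"
    using assms by (simp add: completely_positive_psd channel_def quantum_state_def density_on_def)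
  moreover have "trace (\<Phi> \<rho>) = 1"
    using assms by (auto simp: channel_def quantum_state_def density_on_def trace_def)
  ultimately show ?thesis
    by (simp add: quantum_state_def density_on_def trace_def)
qed


section \<open>The high-temperature limit\<close>

lemma mat_power_scaleR: "mat_power (r *\<^sub>R A) n = r ^ n *\<^sub>R mat_power A n"
proof (induction n)
  case (Suc n)
  then show ?case
    by (simp add: vec_eq_iff matrix_matrix_mult_def scaleR_entry sum_distrib_left mult_ac
        del: vector_scaleR_component)
qed simp

text \<open>Each entry of the exponential is a scalar power series in \<open>r\<close>, so the limit
  and the Hermitian symmetry can be treated entry by entry.\<close>

lemma mat_exp_scaleR_sums:
  "(\<lambda>n. mat_power A n $ i $ j / fact n * complex_of_real r ^ n) sums (mat_exp (r *\<^sub>R A) $ i $ j)"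
proof -
  have "(\<lambda>n. (1 / fact n) *\<^sub>R mat_power (r *\<^sub>R A) n) sums mat_exp (r *\<^sub>R A)"
    unfolding mat_exp_def by (rule summable_sums[OF mat_exp_summable])
  from bounded_linear.sums[OF bounded_linear_vec_nth[of j]
      bounded_linear.sums[OF bounded_linear_vec_nth[of i] this]]
  show ?thesis
    by (simp add: mat_power_scaleR scaleR_entry mult_ac del: vector_scaleR_component)
qed

lemma tendsto_mat_exp_scaleR:
  "((\<lambda>r. mat_exp (r *\<^sub>R A) $ i $ j) \<longlongrightarrow> mat 1 $ i $ j) (at 0)"
proof -
  let ?c = "\<lambda>n. mat_power A n $ i $ j / fact n"
  \<comment> \<open>Convergence at 1 places 0 strictly inside the disc of convergence, where the
    series is continuous.\<close>
  have "summable (\<lambda>n. ?c n * 1 ^ n)"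
    using sums_summable[OF mat_exp_scaleR_sums[of A i j 1]] by simp
  then have "isCont (\<lambda>x. \<Sum>n. ?c n * x ^ n) 0"
    by (rule isCont_powser) simp
  then have "((\<lambda>r. \<Sum>n. ?c n * complex_of_real r ^ n) \<longlongrightarrow> (\<Sum>n. ?c n * 0 ^ n)) (at 0)"
    by (rule isCont_tendsto_compose) (auto intro!: tendsto_eq_intros)
  moreover have "(\<Sum>n. ?c n * complex_of_real r ^ n) = mat_exp (r *\<^sub>R A) $ i $ j" for r
    by (rule sums_unique[symmetric], rule mat_exp_scaleR_sums)
  moreover have "(\<Sum>n. ?c n * 0 ^ n) = mat 1 $ i $ j"
    by (simp only: powser_zero) simp
  ultimately show ?thesis by simp
qed

lemma tendsto_thermal_state:
  fixes H :: "complex^'a::finite^'a"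
  assumes "k > 0"
  shows "((\<lambda>T. thermal_state k H T $ i $ j) \<longlongrightarrow> mat 1 $ i $ j / of_nat CARD('a)) at_top"
proof -
  \<comment> \<open>The filter \<open>at 0\<close> is punctured, so besides tending to 0 the
    argument must eventually be nonzero.\<close>
  have r: "filterlim (\<lambda>T. - 1 / (k * T)) (at 0) at_top"
  proof (rule filterlim_atI)
    show "((\<lambda>T. - 1 / (k * T)) \<longlongrightarrow> 0) at_top"
      using assms by real_asymp
    show "\<forall>\<^sub>F T in at_top. - 1 / (k * T) \<noteq> 0"
      using eventually_gt_at_top[of 0] by eventually_elim (use assms in auto)
  qed
  have lim: "((\<lambda>T. mat_exp ((- 1 / (k * T)) *\<^sub>R H) $ i $ j) \<longlongrightarrow> mat 1 $ i $ j) at_top" for i j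
    by (rule filterlim_compose[OF tendsto_mat_exp_scaleR r])
  have "((\<lambda>T. trace (mat_exp ((- 1 / (k * T)) *\<^sub>R H))) \<longlongrightarrow> (\<Sum>i\<in>UNIV. mat 1 $ i $ (i::'a))) at_top"
    unfolding trace_def by (intro tendsto_sum lim)
  then have tr: "((\<lambda>T. trace (mat_exp ((- 1 / (k * T)) *\<^sub>R H))) \<longlongrightarrow> of_nat CARD('a)) at_top"
    by (simp add: mat_def)
  have "((\<lambda>T. 1 / trace (mat_exp ((- 1 / (k * T)) *\<^sub>R H)) * mat_exp ((- 1 / (k * T)) *\<^sub>R H) $ i $ j)
      \<longlongrightarrow> 1 / of_nat CARD('a) * mat 1 $ i $ j) at_top"
    by (intro tendsto_intros lim tr) simp
  then show ?thesis
    by (simp add: thermal_state_def Let_def cscale_def)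
qed

section \<open>Hermitian symmetry and normalization of thermal states\<close>

lemma mat_power_Suc_right: "mat_power A (Suc n) = mat_power A n ** A"
  by (induction n) (simp_all add: matrix_mul_assoc)

text \<open>Taking adjoints reverses products, so the recursion with \<open>A\<close> on the left
  must be matched with the one with \<open>A\<close> on the right.\<close>

lemma hermitian_mat_power:
  assumes "hermitian A"
  shows "mat_power A n $ i $ j = cnj (mat_power A n $ j $ i)"
proof (induction n arbitrary: i j)
  case 0
  then show ?case by (simp add: mat_def)
next
  case (Suc n)
  have "A $ i $ l = cnj (A $ l $ i)" for l
    using assms unfolding hermitian_def by blast
  then have "mat_power A (Suc n) $ i $ j = (\<Sum>l\<in>UNIV. cnj (A $ l $ i) * cnj (mat_power A n $ j $ l))"
    unfolding mat_power.simps matrix_matrix_mult_def vec_lambda_beta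
    by (intro sum.cong refl arg_cong2[where f = "(*)"] Suc.IH)
  also have "\<dots> = cnj (mat_power A (Suc n) $ j $ i)"
    by (simp add: mat_power_Suc_right matrix_matrix_mult_def mult.commute del: mat_power.simps)
  finally show ?case .
qed

lemma hermitian_mat_exp:
  assumes "hermitian A"
  shows "mat_exp (r *\<^sub>R A) $ i $ j = cnj (mat_exp (r *\<^sub>R A) $ j $ i)"
proof -
  have "(\<lambda>n. cnj (mat_power A n $ j $ i / fact n * complex_of_real r ^ n))
      sums cnj (mat_exp (r *\<^sub>R A) $ j $ i)"
    unfolding sums_cnj by (rule mat_exp_scaleR_sums)
  then have "(\<lambda>n. mat_power A n $ i $ j / fact n * complex_of_real r ^ n)
      sums cnj (mat_exp (r *\<^sub>R A) $ j $ i)"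
    by (simp add: hermitian_mat_power[OF assms, of _ i j])
  with mat_exp_scaleR_sums show ?thesis
    by (rule sums_unique2)
qed

lemma hermitian_thermal_state:
  assumes "hermitian H"
  shows "thermal_state k H T $ i $ j = cnj (thermal_state k H T $ j $ i)"
proof -
  let ?G = "mat_exp ((- 1 / (k * T)) *\<^sub>R H)"
  have "cnj (trace ?G) = trace ?G"
    unfolding trace_def cnj_sum by (intro sum.cong refl hermitian_mat_exp[OF assms, symmetric])
  then show ?thesis
    using hermitian_mat_exp[OF assms, of "- 1 / (k * T)" i j]
    by (simp add: thermal_state_def Let_def cscale_def)
qed

text \<open>Since \<open>1 / 0 = 0\<close>, a vanishing partition function would produce the zero
  matrix; a nonzero result therefore certifies that the normalization took effect.\<close>

lemma trace_thermal_state: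
  assumes "thermal_state k H T \<noteq> 0"
  shows "trace (thermal_state k H T) = 1"
proof -
  let ?G = "mat_exp ((- 1 / (k * T)) *\<^sub>R H)"
  have "trace ?G \<noteq> 0"
    using assms by (auto simp: thermal_state_def Let_def cscale_def vec_eq_iff)
  moreover have "trace (cscale (1 / trace ?G) ?G) = 1 / trace ?G * trace ?G"
    unfolding cscale_def trace_def vec_lambda_beta sum_distrib_left ..
  ultimately show ?thesis
    by (simp add: thermal_state_def Let_def)
qed


section \<open>A witness for genuine multipartite entanglement\<close>

text \<open>Test vectors supported on \<open>x\<close> and \<open>y\<close> see only a 2 by 2
  principal block; the last conclusion says that its determinant is nonnegative.\<close>

lemma psd_on_two:
  assumes "finite I" and "x \<in> I" and "y \<in> I" and "x \<noteq> y" and psd: "psd_on I A"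
  shows "A x x \<in> \<real>\<^sub>\<ge>\<^sub>0" and "A y y \<in> \<real>\<^sub>\<ge>\<^sub>0" and "A y x = cnj (A x y)"
    and "(cmod (A x y))\<^sup>2 \<le> Re (A x x) * Re (A y y)"
proof -
  have form: "cnj \<alpha> * A x x * \<alpha> + cnj \<alpha> * A x y * \<beta> + cnj \<beta> * A y x * \<alpha> + cnj \<beta> * A y y * \<beta> \<in> \<real>\<^sub>\<ge>\<^sub>0"
    for \<alpha> \<beta>
  proof -
    define v where "v z = (if z = x then \<alpha> else if z = y then \<beta> else 0)" for z
    have restrict: "(\<Sum>z\<in>I. g z) = g x + g y" if "\<And>z. z \<noteq> x \<Longrightarrow> z \<noteq> y \<Longrightarrow> g z = 0" for g :: "_ \<Rightarrow> complex"
    proof -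
      have "(\<Sum>z\<in>I. g z) = (\<Sum>z\<in>{x, y}. g z)"
        using assms that by (intro sum.mono_neutral_right) auto
      then show ?thesis using \<open>x \<noteq> y\<close> by simp
    qed
    have "(\<Sum>a\<in>I. \<Sum>b\<in>I. cnj (v a) * A a b * v b)
        = (\<Sum>a\<in>I. cnj (v a) * A a x * \<alpha> + cnj (v a) * A a y * \<beta>)"
      using \<open>x \<noteq> y\<close> by (intro sum.cong refl, subst restrict) (auto simp: v_def)
    also have "\<dots> = cnj \<alpha> * A x x * \<alpha> + cnj \<alpha> * A x y * \<beta> + (cnj \<beta> * A y x * \<alpha> + cnj \<beta> * A y y * \<beta>)"
      using \<open>x \<noteq> y\<close> by (subst restrict) (auto simp: v_def)
    finally have "(\<Sum>a\<in>I. \<Sum>b\<in>I. cnj (v a) * A a b * v b)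
        = cnj \<alpha> * A x x * \<alpha> + cnj \<alpha> * A x y * \<beta> + cnj \<beta> * A y x * \<alpha> + cnj \<beta> * A y y * \<beta>"
      by (simp add: add.assoc)
    moreover have "(\<Sum>a\<in>I. \<Sum>b\<in>I. cnj (v a) * A a b * v b) \<in> \<real>\<^sub>\<ge>\<^sub>0"
      using psd unfolding psd_on_def by blast
    ultimately show ?thesis by simp
  qed
  show x: "A x x \<in> \<real>\<^sub>\<ge>\<^sub>0" and y: "A y y \<in> \<real>\<^sub>\<ge>\<^sub>0"
    using form[of 1 0] form[of 0 1] by simp_all
  \<comment> \<open>Reality of the form at \<open>(1, 1)\<close> gives opposite imaginary parts of
    the off-diagonal entries, and at \<open>(1, \<i>)\<close> equal real parts.\<close>
  show conj: "A y x = cnj (A x y)"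
    using form[of 1 1] form[of 1 \<i>] x y by (auto simp: complex_nonneg_Reals_iff complex_eq_iff)
  obtain p q where p: "A x x = complex_of_real p" "p \<ge> 0" and q: "A y y = complex_of_real q" "q \<ge> 0"
    using x y by (auto simp: nonneg_Reals_def)
  let ?b = "A x y"
  have b: "?b * cnj ?b = complex_of_real ((cmod ?b)\<^sup>2)"
    by (rule complex_norm_square[symmetric])
  \<comment> \<open>The test vector \<open>(- t b, s)\<close> aligns the phases, so that both cross
    terms equal \<open>- t s\<close> times the squared modulus of \<open>b\<close>.\<close>
  have real_form: "t\<^sup>2 * (cmod ?b)\<^sup>2 * p - 2 * t * s * (cmod ?b)\<^sup>2 + s\<^sup>2 * q \<ge> 0" for s t :: real
  proof -
    let ?\<alpha> = "- complex_of_real t * ?b" and ?\<beta> = "complex_of_real s"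
    have "cnj ?\<alpha> * A x x * ?\<alpha> + cnj ?\<alpha> * A x y * ?\<beta> + cnj ?\<beta> * A y x * ?\<alpha> + cnj ?\<beta> * A y y * ?\<beta>
        = of_real (t\<^sup>2) * (?b * cnj ?b) * of_real p - 2 * of_real (t * s) * (?b * cnj ?b) + of_real (s\<^sup>2) * of_real q"
      unfolding conj p q complex_cnj_minus complex_cnj_mult complex_cnj_complex_of_real of_real_mult
        of_real_power
      by algebra
    also have "\<dots> = complex_of_real (t\<^sup>2 * (cmod ?b)\<^sup>2 * p - 2 * t * s * (cmod ?b)\<^sup>2 + s\<^sup>2 * q)"
      unfolding b by simp
    finally show ?thesis
      using form[of ?\<alpha> ?\<beta>] by (simp only: nonneg_Reals_of_real_iff)
  qed
  show "(cmod ?b)\<^sup>2 \<le> Re (A x x) * Re (A y y)"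
  proof (cases "p = 0")
    case True
    have "(cmod ?b)\<^sup>2 = 0"
    proof (rule ccontr)
      assume "(cmod ?b)\<^sup>2 \<noteq> 0"
      \<comment> \<open>For \<open>p = 0\<close> the form is linear in \<open>t\<close>; this
        \<open>t\<close> makes its value \<open>- q - 2\<close>, which is negative.\<close>
      then have "q - 2 * (q + 1) \<ge> 0"
        using real_form[of "(q + 1) / (cmod ?b)\<^sup>2" 1] True by simp
      with q show False by simp
    qed
    then show ?thesis by (simp add: p q)
  next
    case False
    \<comment> \<open>With \<open>t = 1\<close> and \<open>s = p\<close> the form is
      \<open>p\<close> times the determinant.\<close>
    have "p * (p * q - (cmod ?b)\<^sup>2) \<ge> 0"
      using real_form[of 1 p] by (simp add: power2_eq_square algebra_simps)
    moreover have "p > 0"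
      using False p by simp
    ultimately show ?thesis
      by (simp add: zero_le_mult_iff p q)
  qed
qed

lemma density_on_two:
  assumes "finite I" and "x \<in> I" and "y \<in> I" and "x \<noteq> y" and dens: "density_on I A"
  shows "Re (A x x) + Re (A y y) \<le> 1"
proof -
  have psd: "psd_on I A" and tr: "(\<Sum>z\<in>I. A z z) = 1"
    using dens by (auto simp: density_on_def)
  have nonneg: "Re (A z z) \<ge> 0" if "z \<in> I" for z
    using psd_on_two(1)[OF assms(1) that _ _ psd] psd_on_two(2)[OF assms(1) _ that _ psd] assms that
    by (cases "z = x") (auto simp: complex_nonneg_Reals_iff)
  have "Re (A x x) + Re (A y y) = (\<Sum>z\<in>{x, y}. Re (A z z))"
    using \<open>x \<noteq> y\<close> by simp
  also have "\<dots> \<le> (\<Sum>z\<in>I. Re (A z z))"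
    using assms nonneg by (intro sum_mono2) auto
  also have "\<dots> = Re (\<Sum>z\<in>I. A z z)"
    by simp
  finally show ?thesis by (simp add: tr)
qed

text \<open>Twice the fidelity with the GHZ state.\<close>

definition ghz_weight :: "complex^('n::finite \<Rightarrow> 2)^('n \<Rightarrow> 2) \<Rightarrow> real" where
  "ghz_weight \<rho> = Re (\<Sum>a\<in>UNIV. \<Sum>b\<in>UNIV. \<rho> $ (\<lambda>_. a) $ (\<lambda>_. b))"

lemma ghz_weight_add: "ghz_weight (X + Y) = ghz_weight X + ghz_weight Y"
  by (simp add: ghz_weight_def sum.distrib)

lemma ghz_weight_scaleR: "ghz_weight (r *\<^sub>R X) = r * ghz_weight X"
  by (simp add: ghz_weight_def sum_distrib_left)

text \<open>Only the blocks of \<open>A\<close> and \<open>B\<close> on the constant strings enter.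
  Positivity bounds the coherences by the populations, and the arithmetic-geometric mean inequality
  bounds the weight by \<open>(p + q) * (p' + q')\<close>, a product of partial traces of two
  states.\<close>

lemma ghz_weight_product_states:
  fixes \<sigma> :: "complex^('n::finite \<Rightarrow> 2)^('n \<Rightarrow> 2)"
  assumes "\<sigma> \<in> product_states S" and "S \<noteq> {}" and "S \<noteq> UNIV"
  shows "ghz_weight \<sigma> \<le> 1"
proof -
  obtain A B where \<sigma>: "\<sigma> = (\<chi> f g. A (restrict f S) (restrict g S) * B (restrict f (- S)) (restrict g (- S)))"
    and A: "density_on (S \<rightarrow>\<^sub>E UNIV) A" and B: "density_on ((- S) \<rightarrow>\<^sub>E UNIV) B"
    using assms(1) unfolding product_states_def by blast
  define s where "s a = restrict (\<lambda>_. a) S" for a :: 2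
  define t where "t a = restrict (\<lambda>_. a) (- S)" for a :: 2
  obtain i j where i: "i \<in> S" and j: "j \<notin> S"
    using assms by auto
  \<comment> \<open>A party on each side makes the two constant strings distinct there, as the 2 by
    2 block estimates require.\<close>
  have s: "finite (S \<rightarrow>\<^sub>E (UNIV :: 2 set))" "s 1 \<in> S \<rightarrow>\<^sub>E UNIV" "s 2 \<in> S \<rightarrow>\<^sub>E UNIV" "s 1 \<noteq> s 2"
    using i by (auto simp: s_def finite_PiE dest: fun_cong[of _ _ i])
  have t: "finite ((- S) \<rightarrow>\<^sub>E (UNIV :: 2 set))" "t 1 \<in> (- S) \<rightarrow>\<^sub>E UNIV" "t 2 \<in> (- S) \<rightarrow>\<^sub>E UNIV" "t 1 \<noteq> t 2"
    using j by (auto simp: t_def finite_PiE dest: fun_cong[of _ _ j])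
  have psd: "psd_on (S \<rightarrow>\<^sub>E UNIV) A" "psd_on ((- S) \<rightarrow>\<^sub>E UNIV) B"
    using A B by (auto simp: density_on_def)
  note a = psd_on_two[OF s psd(1)] and b = psd_on_two[OF t psd(2)]
  obtain p q p' q' where pq: "A (s 1) (s 1) = complex_of_real p" "p \<ge> 0"
      "A (s 2) (s 2) = complex_of_real q" "q \<ge> 0"
      "B (t 1) (t 1) = complex_of_real p'" "p' \<ge> 0"
      "B (t 2) (t 2) = complex_of_real q'" "q' \<ge> 0"
    using a(1,2) b(1,2) by (auto simp: nonneg_Reals_def)
  have le: "p + q \<le> 1" "p' + q' \<le> 1"
    using density_on_two[OF s A] density_on_two[OF t B] by (simp_all add: pq)
  let ?c = "A (s 1) (s 2) * B (t 1) (t 2)"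
  have "(cmod ?c)\<^sup>2 = (cmod (A (s 1) (s 2)))\<^sup>2 * (cmod (B (t 1) (t 2)))\<^sup>2"
    by (simp add: norm_mult power_mult_distrib)
  also have "\<dots> \<le> (p * q) * (p' * q')"
    using a(4) b(4) pq by (intro mult_mono) auto
  \<comment> \<open>The arithmetic-geometric mean inequality for \<open>p * q'\<close> and
    \<open>q * p'\<close>.\<close>
  also have "\<dots> \<le> ((p * q' + q * p') / 2)\<^sup>2"
    using zero_le_power2[of "p * q' - q * p'"] by (simp add: power2_eq_square algebra_simps)
  finally have c: "cmod ?c \<le> (p * q' + q * p') / 2"
    using pq by (rule_tac power2_le_imp_le) auto
  have "ghz_weight \<sigma> = p * p' + q * q' + Re (?c + cnj ?c)"
    by (simp add: ghz_weight_def \<sigma> sum_2 s_def[symmetric] t_def[symmetric] a(3) b(3) pq)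
  also have "\<dots> \<le> p * p' + q * q' + 2 * cmod ?c"
    using complex_Re_le_cmod[of ?c] by simp
  also have "\<dots> \<le> (p + q) * (p' + q')"
    using c by (simp add: algebra_simps)
  also have "\<dots> \<le> 1 * 1"
    using le pq by (intro mult_mono) auto
  finally show ?thesis by simp
qed

text \<open>The weight is linear, so the set \<open>?W\<close> is convex and absorbs both hulls: the
  one for a fixed bipartition and the one over all of them.\<close>

lemma genuinely_multipartite_entangledI:
  fixes \<rho> :: "complex^('n::finite \<Rightarrow> 2)^('n \<Rightarrow> 2)"
  assumes "quantum_state \<rho>" and "ghz_weight \<rho> > 1"
  shows "genuinely_multipartite_entangled \<rho>"
proof -
  let ?W = "{\<sigma> :: complex^('n \<Rightarrow> 2)^('n \<Rightarrow> 2). ghz_weight \<sigma> \<le> 1}"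
  have convex: "convex ?W"
    unfolding convex_def
    by (auto simp: ghz_weight_add ghz_weight_scaleR intro: convex_bound_le)
  have "separable_states S \<subseteq> ?W" if "S \<noteq> {}" "S \<noteq> UNIV" for S
    unfolding separable_states_def
    using ghz_weight_product_states[OF _ that] by (intro hull_minimal convex) auto
  then have "convex hull (\<Union>S\<in>{S. S \<noteq> {} \<and> S \<noteq> UNIV}. separable_states S) \<subseteq> ?W"
    by (intro hull_minimal convex) auto
  with assms show ?thesis
    by (auto simp: genuinely_multipartite_entangled_def)
qed

text \<open>The weight is the quadratic form of \<open>\<rho>\<close> at the indicator of the
  constant strings.\<close>

lemma ghz_weight_nonneg:
  fixes \<rho> :: "complex^('n::finite \<Rightarrow> 2)^('n \<Rightarrow> 2)"
  assumes "psd_on UNIV (\<lambda>f g. \<rho> $ f $ g)"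
  shows "ghz_weight \<rho> \<ge> 0"
proof -
  let ?c = "\<lambda>a (_ :: 'n). a :: 2"
  have inj: "inj ?c" by (auto simp: inj_def dest: fun_cong)
  define v where "v f = (if f \<in> range ?c then 1 else 0 :: complex)" for f
  have "(\<Sum>f\<in>UNIV. \<Sum>g\<in>UNIV. cnj (v f) * \<rho> $ f $ g * v g) = (\<Sum>f\<in>range ?c. \<Sum>g\<in>range ?c. \<rho> $ f $ g)"
    by (rule sum.mono_neutral_cong_right; (simp add: v_def)?)
       (rule sum.mono_neutral_cong_right; auto simp: v_def)
  also have "\<dots> = (\<Sum>a\<in>UNIV. \<Sum>b\<in>UNIV. \<rho> $ ?c a $ ?c b)"
    by (simp add: sum.reindex[OF inj])
  finally have "(\<Sum>a\<in>UNIV. \<Sum>b\<in>UNIV. \<rho> $ ?c a $ ?c b) \<in> \<real>\<^sub>\<ge>\<^sub>0"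
    using assms unfolding psd_on_def by (elim allE[of _ v]) simp
  then show ?thesis
    unfolding ghz_weight_def complex_nonneg_Reals_iff by (rule conjunct1)
qed


section \<open>Stabilizing the GHZ state\<close>

text \<open>The projector onto the equal superposition of the two constant strings;
  \<open>1 / 2\<close> is the product of two amplitudes.\<close>

definition ghz :: "complex^('n::finite \<Rightarrow> 2)^('n \<Rightarrow> 2)" where
  "ghz = (\<chi> f g. if f \<in> range (\<lambda>a _. a) \<and> g \<in> range (\<lambda>a _. a) then 1 / 2 else 0)"

lemma sum_constant_functions:
  fixes v :: "('n::finite \<Rightarrow> 2) \<Rightarrow> complex"
  shows "(\<Sum>f\<in>UNIV. (if f \<in> range (\<lambda>a _. a) then 1 else 0) * v f) = v (\<lambda>_. 1) + v (\<lambda>_. 2)"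
proof -
  have inj: "inj (\<lambda>a (_ :: 'n). a :: 2)" by (auto simp: inj_def dest: fun_cong)
  have "(\<Sum>f\<in>UNIV. (if f \<in> range (\<lambda>a _. a) then 1 else 0) * v f) = (\<Sum>f\<in>range (\<lambda>a _. a). v f)"
    by (rule sum.mono_neutral_cong_right) auto
  then show ?thesis
    by (simp add: sum.reindex[OF inj] sum_2)
qed

lemma ghz_entry:
  "ghz $ f $ g = 1 / 2 * (if f \<in> range (\<lambda>a _. a) then 1 else 0) * (if g \<in> range (\<lambda>a _. a) then 1 else 0)"
  by (simp add: ghz_def)

text \<open>The matrix has rank one: its form at \<open>v\<close> is half the squared modulus of the
  sum of the two values of \<open>v\<close> on constant strings.\<close>

lemma quantum_state_ghz: "quantum_state (ghz :: complex^('n::finite \<Rightarrow> 2)^('n \<Rightarrow> 2))"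
proof -
  let ?u = "\<lambda>f :: 'n \<Rightarrow> 2. if f \<in> range (\<lambda>a _. a) then 1 else 0 :: complex"
  have "(\<Sum>f\<in>UNIV. \<Sum>g\<in>UNIV. cnj (v f) * ghz $ f $ g * v g) \<in> \<real>\<^sub>\<ge>\<^sub>0" for v :: "('n \<Rightarrow> 2) \<Rightarrow> complex"
  proof -
    let ?w = "v (\<lambda>_. 1) + v (\<lambda>_. 2)"
    have "(\<Sum>f\<in>UNIV. \<Sum>g\<in>UNIV. cnj (v f) * ghz $ f $ g * v g)
        = 1 / 2 * ((\<Sum>f\<in>UNIV. ?u f * cnj (v f)) * (\<Sum>g\<in>UNIV. ?u g * v g))"
      unfolding sum_product unfolding sum_distrib_left ghz_entry by (intro sum.cong refl) simp
    also have "\<dots> = complex_of_real (1 / 2 * (cmod ?w)\<^sup>2)"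
      unfolding sum_constant_functions of_real_mult complex_norm_square by (simp add: mult.commute)
    finally show ?thesis by (simp only: nonneg_Reals_of_real_iff) simp
  qed
  moreover have "(\<Sum>f\<in>UNIV. ghz $ f $ (f :: 'n \<Rightarrow> 2)) = 1"
  proof -
    have "(\<Sum>f\<in>UNIV. ghz $ f $ (f :: 'n \<Rightarrow> 2)) = (\<Sum>f\<in>UNIV. ?u f * (1 / 2))"
      unfolding ghz_entry by (intro sum.cong refl) simp
    then show ?thesis
      unfolding sum_constant_functions by simp
  qed
  ultimately show ?thesis
    by (simp add: quantum_state_def density_on_def psd_on_def)
qed

lemma ghz_weight_ghz: "ghz_weight ghz = 2"
  by (simp add: ghz_weight_def ghz_entry sum_2)

text \<open>\<open>diag(1, z)\<close>, followed by a bit flip if \<open>a\<close> is false.\<close>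

definition phase_flip :: "bool \<Rightarrow> complex \<Rightarrow> complex^2^2" where
  "phase_flip a z = (\<chi> x y. if (x = y) = a then if y = 1 then 1 else z else 0)"

lemma trace_kraus_phase_flip:
  assumes "cmod z = 1"
  shows "trace (kraus {j} (\<lambda>_. phase_flip a z) X) = trace X"
proof (rule trace_kraus)
  have z: "z * cnj z = 1"
    using assms by (simp add: complex_norm_square[symmetric])
  fix x y
  show "(\<Sum>j\<in>{j}. \<Sum>c\<in>UNIV. phase_flip a z $ c $ x * cnj (phase_flip a z $ c $ y)) = (if x = y then 1 else 0)"
    using exhaust_2[of x] exhaust_2[of y] z by (cases a) (auto simp: phase_flip_def sum_2)
qed

text \<open>The phases multiply to \<open>z ^ N = 1\<close> on \<open>|2\<dots>2\<rangle>\<close>, and the flips exchange the two GHZ components.\<close>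

lemma tensor_map_phase_flip_ghz:
  assumes "z ^ CARD('n::finite) = 1"
  shows "tensor_map (\<lambda>_::'n. kraus {j} (\<lambda>_. phase_flip a z)) ghz = ghz"
proof -
  let ?u = "\<lambda>f :: 'n \<Rightarrow> 2. if f \<in> range (\<lambda>a _. a) then 1 else 0 :: complex"
  define P where "P = tensor_op (\<lambda>_ :: 'n. phase_flip a z)"
  have prod: "(\<Prod>i\<in>UNIV. if f i = c then w else 0) = (if f = (\<lambda>_. c) then w ^ CARD('n) else 0)"
    for f :: "'n \<Rightarrow> 2" and c and w :: complex
  proof (cases "f = (\<lambda>_. c)")
    case False
    then obtain i where "f i \<noteq> c" by auto
    then show ?thesis using False by (auto intro!: prod_zero)
  qed simp
  have flip: "(x = 1) = a \<longleftrightarrow> x = (if a then 1 else 2)" "(x = 2) = a \<longleftrightarrow> x = (if a then 2 else 1)" for x :: 2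
    using exhaust_2[of x] by auto
  have P1: "P $ f $ (\<lambda>_. 1) = (if f = (\<lambda>_. if a then 1 else 2) then 1 else 0)" for f
    unfolding P_def tensor_op_def phase_flip_def vec_lambda_beta flip prod by simp
  have P2: "P $ f $ (\<lambda>_. 2) = (if f = (\<lambda>_. if a then 2 else 1) then 1 else 0)" for f
    unfolding P_def tensor_op_def phase_flip_def vec_lambda_beta flip prod using assms by simp
  have range: "f \<in> range (\<lambda>a _. a) \<longleftrightarrow> f = (\<lambda>_. 1) \<or> f = (\<lambda>_. 2)" for f :: "'n \<Rightarrow> 2"
    by (auto simp: UNIV_2)
  have distinct: "(\<lambda>_ :: 'n. 1 :: 2) \<noteq> (\<lambda>_. 2)"
    by (auto dest: fun_cong)
  \<comment> \<open>\<open>P\<close> fixes the unnormalized GHZ vector \<open>?u\<close>: it keeps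
    both components if \<open>a\<close> holds and exchanges them otherwise.\<close>
  have P: "(\<Sum>h\<in>UNIV. ?u h * P $ f $ h) = ?u f" for f
    unfolding sum_constant_functions unfolding P1 P2 range using distinct by (cases a) auto
  have "tensor_map (\<lambda>_::'n. kraus {j} (\<lambda>_. phase_flip a z)) ghz $ f $ g = ghz $ f $ g" for f g
  proof -
    have "PiE UNIV (\<lambda>_ :: 'n. {j}) = {\<lambda>_. j}"
      by (auto simp: PiE_UNIV_domain)
    then have "tensor_map (\<lambda>_::'n. kraus {j} (\<lambda>_. phase_flip a z)) ghz $ f $ g
        = (\<Sum>h\<in>UNIV. \<Sum>l\<in>UNIV. P $ f $ h * ghz $ h $ l * cnj (P $ g $ l))"
      by (simp add: tensor_map_kraus kraus_def P_def)
    also have "\<dots> = 1 / 2 * ((\<Sum>h\<in>UNIV. ?u h * P $ f $ h) * cnj (\<Sum>l\<in>UNIV. ?u l * P $ g $ l))"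
      unfolding cnj_sum sum_product unfolding sum_distrib_left ghz_entry by (intro sum.cong refl) simp
    also have "\<dots> = ghz $ f $ g"
      unfolding P ghz_entry by simp
    finally show ?thesis .
  qed
  then show ?thesis by (simp add: vec_eq_iff)
qed

text \<open>The phases sum to 0, which kills the off-diagonal entries; averaging over the flip
  equalizes the diagonal ones.\<close>

lemma average_phase_flip:
  assumes "N \<noteq> 0" and "\<And>k. cmod (z k) = 1" and "(\<Sum>k<N. z k) = 0"
  shows "(1 / (2 * real N)) *\<^sub>R (\<Sum>a\<in>UNIV. \<Sum>k<N. kraus {j} (\<lambda>_. phase_flip a (z k)) X)
    = cscale (trace X / 2) (mat 1)"
proof -
  have entry: "kraus {j} (\<lambda>_. phase_flip a w) X $ x $ y
      = (\<Sum>b\<in>UNIV. \<Sum>c\<in>UNIV. phase_flip a w $ x $ b * X $ b $ c * cnj (phase_flip a w $ y $ c))" for a w x y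
    by (simp add: kraus_def)
  have z: "z k * cnj (z k) = 1" for k
    using assms(2)[of k] by (simp add: complex_norm_square[symmetric])
  have z': "z k * (c * cnj (z k)) = c" "z k * (cnj (z k) * c) = c" for k c
    using z[of k] by (simp_all add: mult.left_commute mult.assoc[symmetric])
  have cz: "(\<Sum>k<N. cnj (z k)) = 0"
    using assms(3) by (simp flip: cnj_sum)
  have "((1 / (2 * real N)) *\<^sub>R (\<Sum>a\<in>UNIV. \<Sum>k<N. kraus {j} (\<lambda>_. phase_flip a (z k)) X)) $ x $ y
      = cscale (trace X / 2) (mat 1) $ x $ y" for x y
    unfolding scaleR_entry sum_component entry
    using exhaust_2[of x] exhaust_2[of y] assms(1)
    by (auto simp: UNIV_bool phase_flip_def sum_2 cscale_def mat_def trace_def z' mult.assoc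
        sum_distrib_left[symmetric] sum_distrib_right[symmetric] assms(3) cz field_simps)
  then show ?thesis by (simp add: vec_eq_iff)
qed


section \<open>The entanglement-preserving local thermalization\<close>

text \<open>The Kraus operators \<open>R |s><j|\<close> of the map that discards its input and
  prepares \<open>R\<close> times its adjoint.\<close>

definition replacement :: "complex^'d^'d \<Rightarrow> 'd \<times> 'd \<Rightarrow> complex^'d^'d" where
  "replacement R = (\<lambda>(s, j). \<chi> x a. if a = j then R $ x $ s else 0)"

lemma kraus_replacement:
  fixes R :: "complex^'d::finite^'d"
  shows "kraus UNIV (replacement R) X $ x $ y = (\<Sum>s\<in>UNIV. R $ x $ s * cnj (R $ y $ s)) * trace X"
proof -
  have inner: "(\<Sum>a\<in>UNIV. \<Sum>b\<in>UNIV. replacement R (s, j) $ x $ a * X $ a $ b * cnj (replacement R (s, j) $ y $ b))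
      = R $ x $ s * cnj (R $ y $ s) * X $ j $ j" for s j
  proof -
    have "(\<Sum>a\<in>UNIV. \<Sum>b\<in>UNIV. replacement R (s, j) $ x $ a * X $ a $ b * cnj (replacement R (s, j) $ y $ b))
        = (\<Sum>a\<in>UNIV. \<Sum>b\<in>UNIV. if b = j then if a = j then R $ x $ s * X $ a $ b * cnj (R $ y $ s) else 0 else 0)"
      by (intro sum.cong refl) (simp add: replacement_def)
    then show ?thesis by simp
  qed
  have "kraus UNIV (replacement R) X $ x $ y = (\<Sum>(s, j)\<in>UNIV \<times> UNIV. R $ x $ s * cnj (R $ y $ s) * X $ j $ j)"
    unfolding kraus_def vec_lambda_beta UNIV_Times_UNIV by (intro sum.cong refl) (clarsimp simp: inner)
  also have "\<dots> = (\<Sum>s\<in>UNIV. \<Sum>j\<in>UNIV. R $ x $ s * cnj (R $ y $ s) * X $ j $ j)"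
    by (rule sum.cartesian_product[symmetric])
  also have "\<dots> = (\<Sum>s\<in>UNIV. R $ x $ s * cnj (R $ y $ s)) * trace X"
    unfolding trace_def by (rule sum_product[symmetric])
  finally show ?thesis .
qed

text \<open>A Cholesky factor of \<open>4 g - 3/2\<close>, which is positive since \<open>g\<close> is close to \<open>1/2\<close>.\<close>

lemma qubit_factorization:
  fixes g :: "complex^2^2"
  assumes herm: "\<And>x y. g $ x $ y = cnj (g $ y $ x)"
    and near: "\<And>x y. norm (g $ x $ y - mat 1 $ x $ y / 2) < 1 / 16"
  obtains R :: "complex^2^2"
    where "\<And>x y. (\<Sum>s\<in>UNIV. R $ x $ s * cnj (R $ y $ s)) = 4 * g $ x $ y - 3 / 2 * mat 1 $ x $ y"
proof -
  define a where "a = 4 * Re (g $ 1 $ 1) - 3 / 2"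
  define d where "d = 4 * Re (g $ 2 $ 2) - 3 / 2"
  define b where "b = 4 * g $ 1 $ 2"
  \<comment> \<open>Tolerance \<open>1/16\<close> keeps the diagonal of \<open>4 g - 3/2\<close>
    above \<open>4 * 7/16 - 3/2 = 1/4\<close> and the modulus of the off-diagonal entry below
    \<open>4/16 = 1/4\<close>, so the determinant is nonnegative.\<close>
  have diag: "Re (g $ x $ x) > 7 / 16" "Im (g $ x $ x) = 0" for x
    using near[of x x] abs_Re_le_cmod[of "g $ x $ x - mat 1 $ x $ x / 2"] herm[of x x]
    by (auto simp: mat_def complex_eq_iff)
  have a: "a > 1 / 4" and d: "d > 1 / 4"
    using diag(1)[of 1] diag(1)[of 2] by (simp_all add: a_def d_def)
  have "cmod b < 1 / 4"
    using near[of 1 2] by (simp add: b_def mat_def norm_mult)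
  then have "(cmod b)\<^sup>2 \<le> (1 / 4)\<^sup>2"
    by (intro power_mono) auto
  also have "(1 / 4)\<^sup>2 \<le> a * d"
    using a d mult_mono[of "1 / 4" a "1 / 4" d] by (simp add: power2_eq_square)
  finally have det: "(cmod b)\<^sup>2 / a \<le> d"
    using a by (simp add: field_simps)
  \<comment> \<open>The diagonal of the lower triangular factor; \<open>det\<close> makes the second
    radicand nonnegative.\<close>
  define r where "r = complex_of_real (sqrt a)"
  define t where "t = complex_of_real (sqrt (d - (cmod b)\<^sup>2 / a))"
  have r: "r * r = of_real a" "cnj r = r" "r \<noteq> 0" and t: "t * t = of_real (d - (cmod b)\<^sup>2 / a)" "cnj t = t"
    using a det by (simp_all add: r_def t_def flip: of_real_mult)
  have "cnj b / r * (b / r) = of_real ((cmod b)\<^sup>2 / a)"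
    unfolding of_real_divide complex_norm_square r(1)[symmetric] by simp
  then have bt: "cnj b / r * (b / r) + t * t = of_real d"
    unfolding t by (simp flip: of_real_add)
  define R :: "complex^2^2" where
    "R = (\<chi> x s. if x = 1 then if s = 1 then r else 0 else if s = 1 then cnj b / r else t)"
  have g: "g $ 1 $ 1 = of_real a / 4 + 3 / 8" "g $ 2 $ 2 = of_real d / 4 + 3 / 8"
      "g $ 1 $ 2 = b / 4" "g $ 2 $ 1 = cnj b / 4"
    using diag(2) herm[of 2 1] by (simp_all add: a_def d_def b_def complex_eq_iff diff_divide_distrib)
  have "(\<Sum>s\<in>UNIV. R $ x $ s * cnj (R $ y $ s)) = 4 * g $ x $ y - 3 / 2 * mat 1 $ x $ y" for x y
    using exhaust_2[of x] exhaust_2[of y]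
  proof (elim disjE; clarify)
    show "(\<Sum>s\<in>UNIV. R $ 1 $ s * cnj (R $ 1 $ s)) = 4 * g $ 1 $ 1 - 3 / 2 * mat 1 $ 1 $ (1 :: 2)"
      by (simp add: R_def sum_2 r g mat_def)
    show "(\<Sum>s\<in>UNIV. R $ 1 $ s * cnj (R $ 2 $ s)) = 4 * g $ 1 $ 2 - 3 / 2 * mat 1 $ 1 $ (2 :: 2)"
      by (simp add: R_def sum_2 r g mat_def)
    show "(\<Sum>s\<in>UNIV. R $ 2 $ s * cnj (R $ 1 $ s)) = 4 * g $ 2 $ 1 - 3 / 2 * mat 1 $ 2 $ (1 :: 2)"
      by (simp add: R_def sum_2 r g mat_def)
    show "(\<Sum>s\<in>UNIV. R $ 2 $ s * cnj (R $ 2 $ s)) = 4 * g $ 2 $ 2 - 3 / 2 * mat 1 $ 2 $ (2 :: 2)"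
      using bt by (simp add: R_def sum_2 r(2) t(2) g mat_def)
  qed
  then show thesis by (rule that)
qed

lemma roots_of_unity_phases:
  assumes "N \<ge> 2"
  obtains z :: "nat \<Rightarrow> complex"
    where "\<And>k. cmod (z k) = 1" and "\<And>k. k < N \<Longrightarrow> z k ^ N = 1" and "(\<Sum>k<N. z k) = 0"
proof
  let ?z = "\<lambda>k. cis (2 * pi * real k / real N)"
  have bij: "bij_betw ?z {..<N} {w. w ^ N = 1}"
    using assms by (intro Complex.bij_betw_roots_unity) simp
  show "cmod (?z k) = 1" for k
    by simp
  show "?z k ^ N = 1" if "k < N" for k
    using bij_betwE[OF bij] that by blast
  \<comment> \<open>Here \<open>N \<ge> 2\<close> is essential: for \<open>N = 1\<close> the only
    root is 1.\<close>
  show "(\<Sum>k<N. ?z k) = 0"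
    using sum.reindex_bij_betw[OF bij, of "\<lambda>w. w"] sum_roots_unity[of N] assms by simp
qed

text \<open>The two bits of \<open>q\<close> serve to select \<open>A\<close> with probability \<open>1/4\<close>.\<close>

lemma mixture_three_quarters:
  fixes B :: "bool \<Rightarrow> nat \<Rightarrow> 'v::real_vector"
  assumes "N \<noteq> 0"
    and S_def: "S = (UNIV :: (bool \<times> bool) set) \<times> (UNIV :: bool set) \<times> {..<N}"
  shows "(1 / real (card S)) *\<^sub>R (\<Sum>(q, a, k)\<in>S. if q = (True, True) then A else B a k)
    = (1 / 4) *\<^sub>R A + (3 / 4) *\<^sub>R ((1 / (2 * real N)) *\<^sub>R (\<Sum>a\<in>UNIV. \<Sum>k<N. B a k))"
proof -
  have card: "card S = 8 * N"
    by (simp add: S_def card_cartesian_product flip: UNIV_Times_UNIV)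
  let ?t = "\<lambda>q a k. if q = (True, True) then A else B a k"
  have pairs: "(\<Sum>q\<in>UNIV. f q) = (\<Sum>c\<in>UNIV. \<Sum>c'\<in>UNIV. f (c, c'))" for f :: "bool \<times> bool \<Rightarrow> 'v"
    unfolding sum.cartesian_product UNIV_Times_UNIV by (rule sum.cong) auto
  have "(\<Sum>(q, a, k)\<in>S. ?t q a k) = (\<Sum>q\<in>UNIV. \<Sum>a\<in>UNIV. \<Sum>k<N. ?t q a k)"
    unfolding S_def by (simp add: sum.cartesian_product)
  also have "\<dots> = (\<Sum>c\<in>UNIV. \<Sum>c'\<in>UNIV. \<Sum>a\<in>UNIV. \<Sum>k<N. ?t (c, c') a k)"
    by (rule pairs)
  \<comment> \<open>One value of \<open>q\<close> contributes \<open>2 N\<close> copies of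
    \<open>A\<close>, the other three the double sum each. Division by \<open>8 N\<close> gives the
    weights \<open>1/4\<close> and \<open>3/4\<close>.\<close>
  also have "\<dots> = (2 * real N) *\<^sub>R A + 3 *\<^sub>R (\<Sum>a\<in>UNIV. \<Sum>k<N. B a k)"
    by (simp add: UNIV_bool sum_constant_scaleR algebra_simps scaleR_left_distrib[of 2 1, simplified]
        scaleR_left_distrib[of 1 1, simplified])
      (metis mult_2_right scaleR_left_distrib)
  finally show ?thesis
    using assms(1) by (simp add: card scaleR_add_right)
qed

text \<open>\<open>R i\<close> witnesses that \<open>4 \<gamma> i - 3/2\<close> is positive and lets
  \<open>replacement\<close> prepare it. In a shared index \<open>(q, a, k)\<close>,
  \<open>q\<close> selects the branch, \<open>a\<close> the flip and \<open>k\<close> the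
  phase.\<close>

lemma ghz_preserving_local_thermalization:
  fixes \<gamma> R :: "'n::finite \<Rightarrow> complex^2^2"
  assumes N: "CARD('n) \<ge> 2"
    and R: "\<And>i x y. (\<Sum>s\<in>UNIV. R i $ x $ s * cnj (R i $ y $ s)) = 4 * \<gamma> i $ x $ y - 3 / 2 * mat 1 $ x $ y"
    and tr: "\<And>i. trace (\<gamma> i) = 1"
  shows "\<exists>E. local_thermalization \<gamma> E \<and> genuinely_multipartite_entangled (E ghz)"
proof -
  let ?N = "CARD('n)" and ?j = "(1, 1) :: 2 \<times> 2"
  obtain z where z: "\<And>k. cmod (z k) = 1" "\<And>k. k < ?N \<Longrightarrow> z k ^ ?N = 1" "(\<Sum>k<?N. z k) = 0"
    using roots_of_unity_phases[OF N] by blast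
  \<comment> \<open>A unitary branch has a single Kraus operator; the dummy index \<open>?j\<close>
    gives it the same index type as the replacement branch.\<close>
  define J :: "(bool \<times> bool) \<times> bool \<times> nat \<Rightarrow> (2 \<times> 2) set"
    where "J = (\<lambda>(q, a, k). if q = (True, True) then UNIV else {?j})"
  define K :: "(bool \<times> bool) \<times> bool \<times> nat \<Rightarrow> 'n \<Rightarrow> 2 \<times> 2 \<Rightarrow> complex^2^2"
    where "K = (\<lambda>(q, a, k) i. if q = (True, True) then replacement (R i) else (\<lambda>_. phase_flip a (z k)))"
  define F where "F s i = kraus (J s) (K s i)" for s i
  define S where "S = (UNIV :: (bool \<times> bool) set) \<times> (UNIV :: bool set) \<times> {..<?N}"
  define E where "E X = (1 / real (card S)) *\<^sub>R (\<Sum>s\<in>S. tensor_map (F s) X)" for X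
  have S: "finite S" "S \<noteq> {}"
    by (auto simp: S_def lessThan_empty_iff)
  note mix = mixture_three_quarters[OF _ S_def]
  have F: "F (q, a, k) = (if q = (True, True) then (\<lambda>i. kraus UNIV (replacement (R i)))
      else (\<lambda>_. kraus {?j} (\<lambda>_. phase_flip a (z k))))" for q a k
    by (intro ext) (auto simp: F_def J_def K_def)
  \<comment> \<open>The prepared matrix has trace \<open>4 * 1 - 3/2 * 2 = 1\<close>.\<close>
  have "trace (kraus UNIV (replacement (R i)) X) = trace X" for i X
  proof -
    have "trace (kraus UNIV (replacement (R i)) X) = (4 * trace (\<gamma> i) - 3) * trace X"
      unfolding trace_def[of "kraus _ _ _"] kraus_replacement R trace_def[of "\<gamma> i"]
      by (simp add: sum_2 mat_def algebra_simps)
    then show ?thesis by (simp add: tr)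
  qed
  then have trF: "trace (F s i X) = trace X" for s i X
    by (cases s) (auto simp: F trace_kraus_phase_flip z)
  have ch: "channel (F s i)" for s i
    using trF[of s i] by (simp add: F_def channel_def complex_linear_kraus completely_positive_kraus)
  have tch: "channel (tensor_map (F s))" for s
  proof -
    have "F s = (\<lambda>i. kraus (J s) (K s i))"
      by (simp add: F_def fun_eq_iff)
    then show ?thesis
      using trF[of s] by (simp add: channel_tensor_map_kraus)
  qed
  have avg: "(1 / real (card S)) *\<^sub>R (\<Sum>s\<in>S. F s i X) = \<gamma> i" if "trace X = 1" for i X
  proof -
    have "(\<Sum>s\<in>S. F s i X) = (\<Sum>(q, a, k)\<in>S. if q = (True, True) then kraus UNIV (replacement (R i)) X
        else kraus {?j} (\<lambda>_. phase_flip a (z k)) X)"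
      by (intro sum.cong) (auto simp: F)
    then have "(1 / real (card S)) *\<^sub>R (\<Sum>s\<in>S. F s i X)
        = (1 / 4) *\<^sub>R kraus UNIV (replacement (R i)) X + (3 / 4) *\<^sub>R cscale (1 / 2) (mat 1)"
      using average_phase_flip[of ?N z ?j X] z that
      by (simp add: mix)
    \<comment> \<open>\<open>1/4 * (4 \<gamma> i - 3/2) + 3/4 * 1/2 = \<gamma> i\<close>: the choice
      of \<open>4 \<gamma> i - 3/2\<close> is dictated by this equation.\<close>
    also have "\<dots> = \<gamma> i"
      by (simp only: vec_eq_iff vector_add_component scaleR_entry kraus_replacement R that)
         (simp add: cscale_def algebra_simps)
    finally show ?thesis .
  qed
  have lt: "local_thermalization \<gamma> E"
    unfolding E_def[abs_def] using S ch tch avg by (intro local_thermalization_uniform_mixture) auto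
  have "channel E"
    using lt by (simp add: local_thermalization_def)
  then have "quantum_state (E ghz)"
    using quantum_state_ghz by (rule channel_quantum_state)
  \<comment> \<open>The unitary branches alone contribute \<open>3/4 * 2 = 3/2\<close>, and the
    replacement branch cannot lower this.\<close>
  moreover have "ghz_weight (E ghz) > 1"
  proof -
    let ?\<tau> = "tensor_map (\<lambda>i. kraus UNIV (replacement (R i))) ghz"
    have "(\<Sum>s\<in>S. tensor_map (F s) ghz) = (\<Sum>(q, a, k)\<in>S. if q = (True, True) then ?\<tau> else ghz)"
      by (intro sum.cong refl) (auto simp: F S_def tensor_map_phase_flip_ghz z)
    moreover have "(1 / (2 * real ?N)) *\<^sub>R (\<Sum>a\<in>(UNIV :: bool set). \<Sum>k<?N. ghz) = (ghz :: complex^('n \<Rightarrow> 2)^('n \<Rightarrow> 2))"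
      by (simp add: sum_constant_scaleR UNIV_bool del: sum_constant)
    ultimately have "E ghz = (1 / 4) *\<^sub>R ?\<tau> + (3 / 4) *\<^sub>R ghz"
      by (simp only: E_def mix[OF zero_less_card_finite[THEN less_imp_neq, symmetric]])
    moreover have "quantum_state ?\<tau>"
      \<comment> \<open>Any index whose first component is \<open>(True, True)\<close> picks out the
        replacement branch.\<close>
      using channel_quantum_state[OF tch[of "((True, True), True, 0)"] quantum_state_ghz] by (simp add: F)
    then have "ghz_weight ?\<tau> \<ge> 0"
      by (intro ghz_weight_nonneg) (simp add: quantum_state_def density_on_def)
    ultimately show ?thesis
      by (simp add: ghz_weight_add ghz_weight_scaleR ghz_weight_ghz)
  qed
  ultimately show ?thesis
    using lt genuinely_multipartite_entangledI by blast
qed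

theorem mainTheorem5:
  fixes H :: "'n::finite \<Rightarrow> complex^2^2"
    and k :: real
  assumes "CARD('n) \<ge> 2"
    and "k > 0"
    and "\<And>i. hermitian (H i)"
    and "\<And>i. nondegenerate (H i)"
  shows "\<exists>Tmin>0. \<forall>T :: 'n \<Rightarrow> real. (\<forall>i. T i \<ge> Tmin) \<longrightarrow>
           (\<exists>E \<rho>. local_thermalization (\<lambda>i. thermal_state k (H i) (T i)) E \<and>
                  quantum_state \<rho> \<and>
                  genuinely_multipartite_entangled (E \<rho>))"
proof -
  let ?\<gamma> = "\<lambda>i. thermal_state k (H i)"
  have "\<forall>\<^sub>F T in at_top. norm (?\<gamma> i T $ x $ y - mat 1 $ x $ y / 2) < 1 / 16" for i x y
    using tendstoD[OF tendsto_thermal_state[OF assms(2), of "H i" x y], of "1 / 16"]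
    by (simp add: dist_norm)
  \<comment> \<open>Parties and matrix entries are finite in number, so a single threshold serves
    them all, and the temperatures may still differ between parties.\<close>
  then have "\<forall>\<^sub>F T in at_top. \<forall>i x y. norm (?\<gamma> i T $ x $ y - mat 1 $ x $ y / 2) < 1 / 16"
    by (intro eventually_all_finite)
  then obtain T0 where T0: "norm (?\<gamma> i T $ x $ y - mat 1 $ x $ y / 2) < 1 / 16" if "T \<ge> T0" for T i x y
    unfolding eventually_at_top_linorder by blast
  show ?thesis
  \<comment> \<open>The maximum with 1 makes the threshold positive.\<close>
  proof (intro exI[of _ "max T0 1"] conjI allI impI)
    fix T :: "'n \<Rightarrow> real"
    assume "\<forall>i. max T0 1 \<le> T i"
    then have near: "norm (?\<gamma> i (T i) $ x $ y - mat 1 $ x $ y / 2) < 1 / 16" for i x y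
      using T0[of "T i"] by simp
    have "\<exists>R :: complex^2^2. \<forall>x y. (\<Sum>s\<in>UNIV. R $ x $ s * cnj (R $ y $ s))
        = 4 * ?\<gamma> i (T i) $ x $ y - 3 / 2 * mat 1 $ x $ y" for i
      by (rule qubit_factorization[OF hermitian_thermal_state[OF assms(3)] near[of i]]) blast
    then obtain R :: "'n \<Rightarrow> complex^2^2" where R: "\<And>i x y. (\<Sum>s\<in>UNIV. R i $ x $ s * cnj (R i $ y $ s))
        = 4 * ?\<gamma> i (T i) $ x $ y - 3 / 2 * mat 1 $ x $ y"
      by metis
    \<comment> \<open>A diagonal entry within \<open>1/16\<close> of \<open>1/2\<close> cannot
      vanish.\<close>
    have "?\<gamma> i (T i) \<noteq> 0" for i
      using near[of i 1 1] by (auto simp: mat_def)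
    then have "trace (?\<gamma> i (T i)) = 1" for i
      by (rule trace_thermal_state)
    from ghz_preserving_local_thermalization[where \<gamma> = "\<lambda>i. ?\<gamma> i (T i)", OF assms(1) R this]
    show "\<exists>E \<rho>. local_thermalization (\<lambda>i. ?\<gamma> i (T i)) E \<and> quantum_state \<rho> \<and>
        genuinely_multipartite_entangled (E \<rho>)"
      using quantum_state_ghz by blast
  qed simp
qed

end
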